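(* Let $X$ be a finite set with $|X|\geq 3$, and let $\mathcal P$ be a non-trivial uniform partition of $X$. Then $\operatorname{rank} T(X,\mathcal P)=4$ and $\operatorname{rank}\Sigma(X,\mathcal P)=\operatorname{rank}\Gamma(X,\mathcal P)=3$.
   Context: For a finite set $X$, $T(X)$ denotes the full transformation monoid on $X$ (all maps $X\to X$ under composition). Transformations act on the right: $xf$ is the image of $x$ under $f$, and $Pf=\{xf : x\in P\}$ for $P\subseteq X$. A partition $\mathcal P=\{P_1,\ldots,P_m\}$ of $X$ is a collection of pairwise disjoint non-empty subsets (parts) with union $X$; $\sim_{\mathcal P}$ denotes the corresponding equivalence relation. The partition is uniform if $|P_i|=|P_j|$ for all $i,j$. It is trivial if it has $1$ or $|X|$ parts, and non-trivial otherwise. Define the following submonoids of $T(X)$: $$T(X,\mathcal P)=\{f\in T(X) : \text{for all } x,y\in X,\ x\sim_{\mathcal P}y \text{ implies } xf\sim_{\mathcal P}yf\},$$ $$\Sigma(X,\mathcal P)=\{f\in T(X) : \text{for all } x,y\in X,\ x\sim_{\mathcal P}y \text{ if and only if } xf\sim_{\mathcal P}yf\},$$ $$\Gamma(X,\mathcal P)=\{f\in T(X,\mathcal P) : \text{for all } P_i,P_j\in\mathcal P,\ \text{either } P_if\cap P_j=\emptyset \text{ or } P_if=P_j\}.$$ A subset $U$ of a semigroup $S$ generates $S$ if every element of $S$ is expressible as a word in the elements of $U$, with the convention that the empty word represents the identity element. The rank of $S$, $\operatorname{rank} S$, is the minimum of the cardinalities of the generating sets of $S$. *)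

theory Defs
  imports "HOL-Algebra.Group" "HOL-Library.FuncSet" "HOL-Library.Disjoint_Sets"
begin

text \<open>
  Maps \<open>X \<rightarrow> X\<close> are represented by extensional functions, so that distinct elements of
  the carrier are distinct maps. Transformations act on the right: in the product of
  \<open>f\<close> and \<open>g\<close> the map \<open>f\<close> is applied first.
\<close>

definition full_transformation_monoid :: "'a set \<Rightarrow> ('a \<Rightarrow> 'a) monoid" where
  "full_transformation_monoid X =
     \<lparr>carrier = X \<rightarrow>\<^sub>E X, mult = (\<lambda>f g. compose X g f), one = (\<lambda>x\<in>X. x)\<rparr>"

definition same_part :: "'a set set \<Rightarrow> 'a \<Rightarrow> 'a \<Rightarrow> bool" where
  "same_part \<P> x y \<longleftrightarrow> (\<exists>P\<in>\<P>. x \<in> P \<and> y \<in> P)"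

definition uniform_partition :: "'a set set \<Rightarrow> bool" where
  "uniform_partition \<P> \<longleftrightarrow> (\<forall>P\<in>\<P>. \<forall>Q\<in>\<P>. card P = card Q)"

definition trivial_partition :: "'a set \<Rightarrow> 'a set set \<Rightarrow> bool" where
  "trivial_partition X \<P> \<longleftrightarrow> card \<P> = 1 \<or> card \<P> = card X"

definition T_maps :: "'a set \<Rightarrow> 'a set set \<Rightarrow> ('a \<Rightarrow> 'a) set" where
  "T_maps X \<P> = {f \<in> carrier (full_transformation_monoid X).
     \<forall>x\<in>X. \<forall>y\<in>X. same_part \<P> x y \<longrightarrow> same_part \<P> (f x) (f y)}"

definition Sigma_maps :: "'a set \<Rightarrow> 'a set set \<Rightarrow> ('a \<Rightarrow> 'a) set" where
  "Sigma_maps X \<P> = {f \<in> carrier (full_transformation_monoid X).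
     \<forall>x\<in>X. \<forall>y\<in>X. same_part \<P> x y \<longleftrightarrow> same_part \<P> (f x) (f y)}"

definition Gamma_maps :: "'a set \<Rightarrow> 'a set set \<Rightarrow> ('a \<Rightarrow> 'a) set" where
  "Gamma_maps X \<P> = {f \<in> T_maps X \<P>.
     \<forall>P\<in>\<P>. \<forall>Q\<in>\<P>. f ` P \<inter> Q = {} \<or> f ` P = Q}"

definition T_monoid :: "'a set \<Rightarrow> 'a set set \<Rightarrow> ('a \<Rightarrow> 'a) monoid" where
  "T_monoid X \<P> = full_transformation_monoid X \<lparr>carrier := T_maps X \<P>\<rparr>"

definition Sigma_monoid :: "'a set \<Rightarrow> 'a set set \<Rightarrow> ('a \<Rightarrow> 'a) monoid" where
  "Sigma_monoid X \<P> = full_transformation_monoid X \<lparr>carrier := Sigma_maps X \<P>\<rparr>"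

definition Gamma_monoid :: "'a set \<Rightarrow> 'a set set \<Rightarrow> ('a \<Rightarrow> 'a) monoid" where
  "Gamma_monoid X \<P> = full_transformation_monoid X \<lparr>carrier := Gamma_maps X \<P>\<rparr>"

definition word_value :: "('a, 'b) monoid_scheme \<Rightarrow> 'a list \<Rightarrow> 'a" where
  "word_value M w = foldr (mult M) w (one M)"

definition generates :: "('a, 'b) monoid_scheme \<Rightarrow> 'a set \<Rightarrow> bool" where
  "generates M U \<longleftrightarrow> U \<subseteq> carrier M \<and> (\<forall>s\<in>carrier M. \<exists>w\<in>lists U. word_value M w = s)"

text \<open>
  The minimum is taken over the finite generating sets (\<^const>\<open>card\<close> is \<open>0\<close> on infinite
  sets), so this is meaningful for finitely generated monoids only.
\<close>

definition monoid_rank :: "('a, 'b) monoid_scheme \<Rightarrow> nat" where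
  "monoid_rank M = (LEAST n. \<exists>U. generates M U \<and> finite U \<and> card U = n)"

lemma monoid_full_transformation_monoid: "monoid (full_transformation_monoid X)"
proof (rule monoidI)
  fix f g h
  assume "f \<in> carrier (full_transformation_monoid X)"
  then show "f \<otimes>\<^bsub>full_transformation_monoid X\<^esub> g \<otimes>\<^bsub>full_transformation_monoid X\<^esub> h =
        f \<otimes>\<^bsub>full_transformation_monoid X\<^esub> (g \<otimes>\<^bsub>full_transformation_monoid X\<^esub> h)"
    by (auto simp: full_transformation_monoid_def compose_def fun_eq_iff)
qed (auto simp: full_transformation_monoid_def compose_def fun_eq_iff PiE_iff extensional_def)

lemma submonoid_T_maps: "submonoid (T_maps X \<P>) (full_transformation_monoid X)"
proof
  fix f g
  assume f: "f \<in> T_maps X \<P>" and g: "g \<in> T_maps X \<P>"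
  have cl: "f x \<in> X" "g x \<in> X" if "x \<in> X" for x
    using that f g by (auto simp: T_maps_def full_transformation_monoid_def PiE_iff)
  have "same_part \<P> (g (f x)) (g (f y))" if "x \<in> X" "y \<in> X" "same_part \<P> x y" for x y
    using that f g cl unfolding T_maps_def by blast
  then show "f \<otimes>\<^bsub>full_transformation_monoid X\<^esub> g \<in> T_maps X \<P>"
    using cl by (simp add: T_maps_def full_transformation_monoid_def compose_def)
qed (auto simp: T_maps_def full_transformation_monoid_def)

lemma submonoid_Sigma_maps: "submonoid (Sigma_maps X \<P>) (full_transformation_monoid X)"
proof
  fix f g
  assume f: "f \<in> Sigma_maps X \<P>" and g: "g \<in> Sigma_maps X \<P>"
  have cl: "f x \<in> X" "g x \<in> X" if "x \<in> X" for x
    using that f g by (auto simp: Sigma_maps_def full_transformation_monoid_def PiE_iff)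
  have "same_part \<P> x y \<longleftrightarrow> same_part \<P> (g (f x)) (g (f y))" if "x \<in> X" "y \<in> X" for x y
    using that f g cl unfolding Sigma_maps_def by blast
  then show "f \<otimes>\<^bsub>full_transformation_monoid X\<^esub> g \<in> Sigma_maps X \<P>"
    using cl by (simp add: Sigma_maps_def full_transformation_monoid_def compose_def)
qed (auto simp: Sigma_maps_def full_transformation_monoid_def)

lemma submonoid_Gamma_maps:
  assumes "partition_on X \<P>"
  shows "submonoid (Gamma_maps X \<P>) (full_transformation_monoid X)"
proof
  let ?F = "full_transformation_monoid X"
  have sub: "P \<subseteq> X" if "P \<in> \<P>" for P
    using that assms by (auto simp: partition_on_def)
  have disj: "P \<inter> Q = {} \<or> P = Q" if "P \<in> \<P>" "Q \<in> \<P>" for P Q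
    using that assms by (auto simp: partition_on_def disjoint_def)
  have Gamma_iff: "h \<in> Gamma_maps X \<P> \<longleftrightarrow> h \<in> T_maps X \<P> \<and> (\<forall>P\<in>\<P>. h ` P \<in> \<P>)" for h
  proof
    assume h: "h \<in> Gamma_maps X \<P>"
    have "h ` P \<in> \<P>" if P: "P \<in> \<P>" for P
    proof -
      have "P \<noteq> {}"
        using P assms by (auto simp: partition_on_def)
      then obtain x where x: "x \<in> P" by blast
      then have "x \<in> X"
        using sub[OF P] by blast
      then have "h x \<in> X"
        using h by (auto simp: Gamma_maps_def T_maps_def full_transformation_monoid_def)
      then obtain Q where Q: "Q \<in> \<P>" "h x \<in> Q"
        using assms by (auto simp: partition_on_def)
      then have "h ` P \<inter> Q \<noteq> {}"
        using x by blast
      then have "h ` P = Q"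
        using h P Q(1) unfolding Gamma_maps_def by blast
      then show ?thesis
        using Q(1) by simp
    qed
    then show "h \<in> T_maps X \<P> \<and> (\<forall>P\<in>\<P>. h ` P \<in> \<P>)"
      using h by (simp add: Gamma_maps_def)
  next
    assume "h \<in> T_maps X \<P> \<and> (\<forall>P\<in>\<P>. h ` P \<in> \<P>)"
    then show "h \<in> Gamma_maps X \<P>"
      unfolding Gamma_maps_def using disj by blast
  qed
  show "Gamma_maps X \<P> \<subseteq> carrier ?F"
    unfolding Gamma_maps_def T_maps_def by blast
  have "(\<lambda>x\<in>X. x) ` P = P" if "P \<in> \<P>" for P
    using sub[OF that] by force
  then show "\<one>\<^bsub>?F\<^esub> \<in> Gamma_maps X \<P>"
    using submonoid.one_closed[OF submonoid_T_maps, of X \<P>]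
    by (simp add: Gamma_iff full_transformation_monoid_def)
  fix f g
  assume f: "f \<in> Gamma_maps X \<P>" and g: "g \<in> Gamma_maps X \<P>"
  have "(f \<otimes>\<^bsub>?F\<^esub> g) ` P = g ` (f ` P)" if "P \<in> \<P>" for P
    using sub[OF that]
    by (force simp: full_transformation_monoid_def compose_def image_image intro!: image_cong)
  moreover have "f \<otimes>\<^bsub>?F\<^esub> g \<in> T_maps X \<P>"
    using f g by (intro submonoid.m_closed[OF submonoid_T_maps]) (auto simp: Gamma_maps_def)
  ultimately show "f \<otimes>\<^bsub>?F\<^esub> g \<in> Gamma_maps X \<P>"
    using f g by (simp add: Gamma_iff)
qed

end

theory Submission
  imports Defs "HOL-Combinatorics.Permutations"
begin

text \<open>
  Number the \<open>m\<close> parts of \<open>\<P>\<close> and the \<open>n\<close> points of each part; non-triviality says exactly that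
  \<open>m, n \<ge> 2\<close>. A map preserving \<open>\<P>\<close> then becomes \<open>(i, j) \<mapsto> (s i, g i j)\<close> with a top map \<open>s\<close> on
  the \<open>m\<close> blocks and one fibre map \<open>g i\<close> for each block. Writing \<open>T\<^sub>k\<close> and \<open>S\<^sub>k\<close> for the full
  transformation monoid and the symmetric group on \<open>k\<close> points, \<open>T(X, \<P>)\<close> is the wreath product
  \<open>T\<^sub>n wr T\<^sub>m\<close>; the maps in \<open>\<Sigma>(X, \<P>)\<close> are those whose top map is a permutation, and the maps in
  \<open>\<Gamma>(X, \<P>)\<close> are those whose fibre maps are all permutations. All three monoids contain the group
  \<open>S\<^sub>n wr S\<^sub>m\<close>.

  Upper bounds. The heart of the matter is that \<open>S\<^sub>n wr S\<^sub>m\<close> is generated by two elements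
  (\<open>units_generated\<close>). Each symmetric group \<open>S\<^sub>k\<close> is generated by the transposition \<open>(0 1)\<close> and a
  cycle of odd length, namely the cycle on all \<open>k\<close> points for odd \<open>k\<close> and on the points other than
  \<open>0\<close> for even \<open>k\<close>. A product of two commuting elements of coprime finite orders generates both
  factors, so one generator can carry a transposition in one place and an odd cycle in another.
  For even \<open>m\<close> this separates everything at once. For odd \<open>m\<close> the top cycle moves every block, so
  it cannot be paired with a commuting transposition inside a single block; there, the two
  generators yield a transposition acting in all blocks and one acting in two adjacent blocks,
  and since \<open>m\<close> is odd a transposition in a single block results. Once all permutations of blocks
  and of points are available, adding a map that identifies two blocks extends \<open>S\<^sub>m\<close> to \<open>T\<^sub>m\<close>,
  and adding a map that identifies two points of one block extends \<open>S\<^sub>n\<close> to \<open>T\<^sub>n\<close>. This gives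
  three generators for \<open>\<Sigma>\<close> and for \<open>\<Gamma>\<close>, and four for \<open>T\<close>.

  Lower bounds. Call a submonoid factor-closed if a product lies in it only when both factors do.
  A factor-closed submonoid is generated by the generators that lie in it. The injective maps form
  a non-commutative factor-closed submonoid, hence need two generators, and every strict step in a
  chain of factor-closed submonoids needs a further one. For \<open>\<Sigma>\<close> and \<open>\<Gamma>\<close> the chain is
  injective maps \<open>\<subset>\<close> everything; for \<open>T\<close> it is injective maps \<open>\<subset> \<Sigma> \<subset> T\<close>.
\<close>

section \<open>Closed sets of maps and elements of finite order\<close>

definition comp_closed :: "('b \<Rightarrow> 'b) set \<Rightarrow> bool" where
  "comp_closed A \<longleftrightarrow> id \<in> A \<and> (\<forall>f\<in>A. \<forall>g\<in>A. f \<circ> g \<in> A)"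

lemma comp_closed_comp: "comp_closed A \<Longrightarrow> f \<in> A \<Longrightarrow> g \<in> A \<Longrightarrow> f \<circ> g \<in> A"
  by (simp add: comp_closed_def)

lemma comp_closed_funpow: "comp_closed A \<Longrightarrow> f \<in> A \<Longrightarrow> f ^^ k \<in> A"
  by (induction k) (auto simp: comp_closed_def)

lemma finite_order_inv:
  assumes "f ^^ q = id" "q > 0"
  shows "bij f" "inv_into UNIV f = f ^^ (q - 1)"
proof -
  obtain p where p: "q = Suc p" using assms(2) by (cases q) auto
  have 1: "f \<circ> f ^^ p = id" "f ^^ p \<circ> f = id"
    using assms(1) unfolding p by (simp_all add: funpow_swap1 fun_eq_iff)
  show "bij f" using 1 o_bij by blast
  show "inv_into UNIV f = f ^^ (q - 1)" using inv_unique_comp[OF 1] p by simp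
qed

lemma comp_closed_inv:
  assumes "comp_closed A" "f \<in> A" "f ^^ q = id" "q > 0"
  shows "inv_into UNIV f \<in> A"
  using comp_closed_funpow[OF assms(1,2)] finite_order_inv[OF assms(3,4)] by simp

lemma funpow_comp_commute:
  assumes "f \<circ> g = g \<circ> f"
  shows "(f \<circ> g) ^^ k = f ^^ k \<circ> g ^^ k"
proof (induction k)
  case (Suc k)
  have *: "g \<circ> f ^^ k = f ^^ k \<circ> g"
    using assms by (induction k) (simp_all add: fun_eq_iff, metis)
  have "(f \<circ> g) ^^ Suc k = f \<circ> (g \<circ> f ^^ k) \<circ> g ^^ k"
    by (simp only: Suc funpow.simps comp_assoc)
  also have "\<dots> = f ^^ Suc k \<circ> g ^^ Suc k"
    unfolding * by (simp only: comp_assoc funpow.simps)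
  finally show ?case .
qed simp

text \<open>
  By Bezout some \<open>b * x\<close> is congruent to \<open>1\<close> modulo \<open>a\<close>; as \<open>f\<close> and \<open>g\<close> commute, raising
  \<open>f \<circ> g\<close> to this power leaves \<open>f\<close> and kills \<open>g\<close>.
\<close>

lemma coprime_orders_left_factor:
  assumes A: "comp_closed A" and fg: "f \<circ> g \<in> A" "f \<circ> g = g \<circ> f"
    and ord: "f ^^ a = id" "g ^^ b = id" "coprime a b" "b > 0"
  shows "f \<in> A"
proof -
  obtain x y where xy: "b * x = a * y + 1"
    using bezout_nat[of b a] ord(3,4) by (auto simp: coprime_iff_gcd_eq_1 gcd.commute)
  have pow: "h ^^ (c * e) = id" if "h ^^ c = id" for h :: "'a \<Rightarrow> 'a" and c e
    using that by (simp flip: funpow_mult)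
  have "f ^^ (b * x) = f" "g ^^ (b * x) = id"
    using pow[OF ord(1), of y] pow[OF ord(2), of x] by (simp_all add: xy)
  then have "(f \<circ> g) ^^ (b * x) = f"
    by (simp only: funpow_comp_commute[OF fg(2)] comp_id)
  then show ?thesis
    using comp_closed_funpow[OF A fg(1), of "b * x"] by simp
qed

lemma coprime_orders_factors:
  assumes A: "comp_closed A" and fg: "f \<circ> g \<in> A" "f \<circ> g = g \<circ> f"
    and ord: "f ^^ a = id" "g ^^ b = id" "coprime a b" "a > 0" "b > 0"
  shows "f \<in> A" "g \<in> A"
proof -
  show "f \<in> A" using coprime_orders_left_factor[OF A fg ord(1-3,5)] .
  have "g \<circ> f \<in> A" using fg by metis
  then show "g \<in> A"
    using coprime_orders_left_factor[OF A _ fg(2)[symmetric] ord(2,1)] ord(3,4)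
    by (simp add: coprime_commute)
qed

section \<open>Generators of the symmetric group and of the full transformation monoid\<close>

abbreviation swap :: "'b \<Rightarrow> 'b \<Rightarrow> 'b \<Rightarrow> 'b" where
  "swap \<equiv> Transposition.transpose"

text \<open>
  The identity outside \<open>{..<k}\<close> makes a map determined by its values below \<open>k\<close>, as for
  \<open>permutes\<close>, so that composition needs no restriction.
\<close>

definition self_maps :: "nat \<Rightarrow> (nat \<Rightarrow> nat) set" where
  "self_maps k = {f. \<forall>x. (x < k \<longrightarrow> f x < k) \<and> (k \<le> x \<longrightarrow> f x = x)}"

abbreviation perms :: "nat \<Rightarrow> (nat \<Rightarrow> nat) set" where
  "perms k \<equiv> {p. p permutes {..<k}}"

lemma perms_subset_self_maps: "perms k \<subseteq> self_maps k"
  by (auto simp: self_maps_def permutes_not_in) (metis lessThan_iff permutes_in_image)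

lemma inj_self_map_permutes:
  assumes "f \<in> self_maps k" "inj_on f {..<k}"
  shows "f permutes {..<k}"
proof (rule bij_imp_permutes)
  have "f ` {..<k} \<subseteq> {..<k}" using assms(1) by (auto simp: self_maps_def)
  then have "f ` {..<k} = {..<k}" by (intro endo_inj_surj assms(2)) auto
  then show "bij_betw f {..<k} {..<k}" using assms(2) by (simp add: bij_betw_def)
qed (use assms(1) in \<open>auto simp: self_maps_def\<close>)

lemma transpose_in_perms: "a < k \<Longrightarrow> b < k \<Longrightarrow> swap a b \<in> perms k"
  by (simp add: permutes_swap_id)

text \<open>
  The cycle \<open>r \<rightarrow> r + 1 \<rightarrow> \<dots> \<rightarrow> k - 1 \<rightarrow> r\<close> has odd length for \<open>r = 0\<close> if \<open>k\<close> is odd and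
  for \<open>r = 1\<close> if \<open>k\<close> is even. For \<open>k = 2\<close> it is the identity.
\<close>

definition odd_start :: "nat \<Rightarrow> nat" where
  "odd_start k = (if odd k then 0 else 1)"

definition odd_cycle :: "nat \<Rightarrow> nat \<Rightarrow> nat" where
  "odd_cycle k j = (let r = odd_start k in
     if r \<le> j \<and> j < k then r + (j - r + 1) mod (k - r) else j)"

lemma odd_cycle_start:
  "e < k - odd_start k \<Longrightarrow>
     odd_cycle k (odd_start k + e) = odd_start k + Suc e mod (k - odd_start k)"
  by (simp add: odd_cycle_def Let_def)

lemma odd_cycle_outside: "\<not> (odd_start k \<le> j \<and> j < k) \<Longrightarrow> odd_cycle k j = j"
  by (auto simp: odd_cycle_def Let_def)

lemma odd_cycle_funpow:
  assumes "e < k - odd_start k"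
  shows "(odd_cycle k ^^ i) (odd_start k + e) = odd_start k + (e + i) mod (k - odd_start k)"
proof (induction i)
  case (Suc i)
  have "(e + i) mod (k - odd_start k) < k - odd_start k" using assms by simp
  from odd_cycle_start[OF this] show ?case
    by (simp add: Suc mod_Suc_eq)
qed (use assms in simp)

lemma odd_cycle_order: "odd_cycle k ^^ (k - odd_start k) = id"
proof
  fix j
  show "(odd_cycle k ^^ (k - odd_start k)) j = id j"
  proof (cases "odd_start k \<le> j \<and> j < k")
    case True
    then obtain e where "j = odd_start k + e" "e < k - odd_start k"
      by (intro that[of "j - odd_start k"]) auto
    moreover from this have "(e + (k - odd_start k)) mod (k - odd_start k) = e"
      by (simp only: mod_add_self2 mod_less)
    ultimately show ?thesis by (simp only: odd_cycle_funpow id_apply)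
  next
    case False
    then have "(odd_cycle k ^^ i) j = j" for i
      by (induction i) (simp_all add: odd_cycle_outside)
    then show ?thesis by simp
  qed
qed

lemma odd_order: "k \<ge> 2 \<Longrightarrow> odd (k - odd_start k)"
  by (auto simp: odd_start_def)

lemma odd_order_pos: "k \<ge> 2 \<Longrightarrow> k - odd_start k > 0"
  by (auto simp: odd_start_def)

lemma odd_cycle_bij: "k \<ge> 2 \<Longrightarrow> bij (odd_cycle k)"
  using finite_order_inv(1)[OF odd_cycle_order odd_order_pos] .

lemma odd_cycle_lt:
  assumes "j < k" shows "odd_cycle k j < k"
proof (cases "odd_start k \<le> j")
  case True
  then have "(j - odd_start k + 1) mod (k - odd_start k) < k - odd_start k"
    using assms by (intro mod_less_divisor) auto
  then have "odd_start k + (j - odd_start k + 1) mod (k - odd_start k) < k" by linarith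
  then show ?thesis using True assms by (simp only: odd_cycle_def Let_def simp_thms if_True)
qed (use assms in \<open>simp add: odd_cycle_outside\<close>)

lemma odd_cycle_in_perms:
  assumes "k \<ge> 2" shows "odd_cycle k \<in> perms k"
proof -
  have "inj_on (odd_cycle k) {..<k}"
    using bij_is_inj[OF odd_cycle_bij[OF assms]] by (rule inj_on_subset) simp
  moreover have "odd_cycle k \<in> self_maps k"
    by (simp add: self_maps_def odd_cycle_lt odd_cycle_outside)
  ultimately show ?thesis using inj_self_map_permutes by simp
qed

lemma odd_cycle_Suc: "odd_start k \<le> j \<Longrightarrow> Suc j < k \<Longrightarrow> odd_cycle k j = Suc j"
  by (auto simp: odd_cycle_def Let_def)

lemma odd_cycle_even_zero: "even k \<Longrightarrow> odd_cycle k 0 = 0"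
  by (simp add: odd_cycle_def odd_start_def)

lemma transpose_conj:
  assumes "bij f" shows "f \<circ> swap a b \<circ> inv_into UNIV f = swap (f a) (f b)"
proof -
  have "f \<circ> swap a b = swap (f a) (f b) \<circ> f"
    using assms by (auto simp: fun_eq_iff Transposition.transpose_def bij_def inj_eq)
  then have "f \<circ> swap a b \<circ> inv_into UNIV f = swap (f a) (f b) \<circ> (f \<circ> inv_into UNIV f)"
    by (simp add: comp_assoc)
  then show ?thesis using assms by (simp add: bij_def surj_iff)
qed

text \<open>
  The transpositions \<open>(0 i)\<close> arise one after the other. Conjugating \<open>(0 i)\<close> by the cycle gives
  \<open>(0 i+1)\<close> if the cycle fixes \<open>0\<close>, and \<open>(1 i+1)\<close> otherwise, which \<open>(0 1)\<close> turns into \<open>(0 i+1)\<close>.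
  It suffices that the set is closed under conjugation by the cycle: in the wreath product, the
  maps available in block \<open>0\<close> can be conjugated by a cycle acting in several blocks before that
  cycle is known to be available in block \<open>0\<close> alone.
\<close>

lemma perms_generated:
  assumes k: "k \<ge> 2" and A: "comp_closed A" and t: "swap 0 1 \<in> A"
    and conj: "\<And>f. f \<in> A \<Longrightarrow> odd_cycle k \<circ> f \<circ> inv_into UNIV (odd_cycle k) \<in> A"
  shows "perms k \<subseteq> A"
proof -
  let ?d = "odd_cycle k"
  have triangle: "swap b c \<in> A" if "swap a b \<in> A" "swap a c \<in> A" "a \<noteq> c" "b \<noteq> c"
    for a b c :: nat
  proof -
    have "swap a b \<circ> swap a c \<circ> swap a b = swap b c"
      using that(3,4) by (auto simp: fun_eq_iff Transposition.transpose_def)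
    then show ?thesis using that(1,2) A by (metis comp_closed_comp)
  qed
  have star: "swap 0 (Suc i) \<in> A" if "Suc i < k" for i
    using that
  proof (induction i)
    case 0
    show ?case using t by simp
  next
    case (Suc i)
    have "?d \<circ> swap 0 (Suc i) \<circ> inv_into UNIV ?d \<in> A"
      using Suc by (intro conj) simp
    then have *: "swap (?d 0) (Suc (Suc i)) \<in> A"
      using odd_cycle_Suc[of k "Suc i"] Suc.prems
      by (simp add: transpose_conj odd_cycle_bij k odd_start_def)
    show ?case
    proof (cases "even k")
      case True
      then show ?thesis using * by (simp add: odd_cycle_even_zero)
    next
      case False
      then have "?d 0 = 1"
        using odd_cycle_Suc[of k 0] k by (simp add: odd_start_def)
      then show ?thesis
        using triangle[of 1 0 "Suc (Suc i)"] * t by (simp add: Transposition.transpose_commute)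
    qed
  qed
  have all: "swap a b \<in> A" if "a < k" "b < k" "a \<noteq> b" for a b
    using that triangle[of 0 a b] star[of "a - 1"] star[of "b - 1"]
    by (cases a; cases b) (auto simp: Transposition.transpose_commute)
  have "p \<in> A" if "p permutes {..<k}" for p
    using that finite_lessThan
  proof (induction rule: permutes_induct)
    case id
    show ?case using A unfolding comp_closed_def by blast
  next
    case (swap a b p)
    then show ?case by (intro comp_closed_comp[OF A] all) simp_all
  qed
  then show ?thesis by auto
qed

definition collapse :: "nat \<Rightarrow> nat" where
  "collapse = id(0 := 1)"

text \<open>
  A non-injective \<open>f\<close> identifies some \<open>a\<close> and \<open>b\<close> and misses some value \<open>c\<close>. Sending \<open>a\<close> to \<open>c\<close>
  instead gives a map with larger image, and \<open>f\<close> is recovered from it by identifying \<open>c\<close> with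
  \<open>f b\<close>. All maps identifying one point with another are conjugate under the permutations.
\<close>

lemma self_maps_generated:
  assumes A: "comp_closed A" and k: "k \<ge> 2" and perms: "perms k \<subseteq> A" and e: "collapse \<in> A"
  shows "self_maps k \<subseteq> A"
proof
  fix f assume "f \<in> self_maps k"
  then show "f \<in> A"
  proof (induction "k - card (f ` {..<k})" arbitrary: f rule: less_induct)
    case less
    have fk: "f ` {..<k} \<subseteq> {..<k}"
      using less.prems by (auto simp: self_maps_def)
    show ?case
    proof (cases "inj_on f {..<k}")
      case True
      then show ?thesis using inj_self_map_permutes[OF less.prems] perms by auto
    next
      case False
      then obtain a b where ab: "a < k" "b < k" "a \<noteq> b" "f a = f b"
        by (auto simp: inj_on_def)
      have "card (f ` {..<k}) < card {..<k}"
        using False by (metis card_image_le eq_card_imp_inj_on finite_lessThan le_neq_implies_less)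
      then obtain c where c: "c < k" "c \<notin> f ` {..<k}"
        using fk by (metis lessThan_iff less_irrefl subsetI subset_antisym)
      define f' where "f' = f(a := c)"
      have "f' ` {..<k} = insert c (f ` {..<k})"
        using ab by (auto simp: f'_def image_iff)
      moreover have "card (insert c (f ` {..<k})) \<le> card {..<k}"
        using c(1) fk by (intro card_mono) auto
      ultimately have "k - card (f' ` {..<k}) < k - card (f ` {..<k})"
        using c by simp
      moreover have "f' \<in> self_maps k"
        using less.prems ab c by (auto simp: f'_def self_maps_def)
      ultimately have f': "f' \<in> A" by (rule less.hyps)
      define d where "d = f b"
      have dk: "d < k" using ab fk by (auto simp: d_def)
      have cd: "c \<noteq> d" using c ab by (auto simp: d_def)
      (* a permutation with p 0 = c and p 1 = d, which conjugates the collapse to id(c := d) *)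
      define p where "p = swap 0 c \<circ> swap 1 (swap 0 c d)"
      have pp: "p permutes {..<k}"
        unfolding p_def using k c(1) dk
        by (intro permutes_compose permutes_swap_id) (auto simp: Transposition.transpose_def)
      have p01: "p 0 = c" "p 1 = d"
        using cd by (auto simp: p_def Transposition.transpose_def)
      have "p \<circ> collapse \<circ> inv_into UNIV p = id(c := d)"
      proof
        fix x
        obtain y where y: "x = p y" using permutes_surj[OF pp] by blast
        show "(p \<circ> collapse \<circ> inv_into UNIV p) x = (id(c := d)) x"
          using p01 permutes_inj[OF pp] by (auto simp: y collapse_def inj_eq)
      qed
      moreover have "p \<in> A" "inv_into UNIV p \<in> A"
        using pp permutes_inv[OF pp] perms by auto
      ultimately have "id(c := d) \<in> A"
        using A e by (metis comp_closed_comp)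
      moreover have "id(c := d) \<circ> f' = f"
      proof
        fix x
        have "f x \<noteq> c"
          using c less.prems by (cases "x < k") (auto simp: self_maps_def)
        then show "(id(c := d) \<circ> f') x = f x"
          using ab by (simp add: f'_def d_def)
      qed
      ultimately show ?thesis using A f' by (metis comp_closed_comp)
    qed
  qed
qed

section \<open>Wreath coordinates\<close>

text \<open>
  The pair \<open>(i, j)\<close> stands for point \<open>j\<close> of block \<open>i\<close>. A wreath map is a product of a map
  permuting or merging whole blocks (\<open>top_map\<close>) with maps acting inside blocks; \<open>base_map S g\<close>
  acts by the same \<open>g\<close> in every block of \<open>S\<close>.
\<close>

definition wreath :: "(nat \<Rightarrow> nat) \<Rightarrow> (nat \<Rightarrow> nat \<Rightarrow> nat) \<Rightarrow> nat \<times> nat \<Rightarrow> nat \<times> nat" where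
  "wreath s g = (\<lambda>(i, j). (s i, g i j))"

definition top_map :: "(nat \<Rightarrow> nat) \<Rightarrow> nat \<times> nat \<Rightarrow> nat \<times> nat" where
  "top_map s = (\<lambda>(i, j). (s i, j))"

definition base_map :: "nat set \<Rightarrow> (nat \<Rightarrow> nat) \<Rightarrow> nat \<times> nat \<Rightarrow> nat \<times> nat" where
  "base_map S g = (\<lambda>(i, j). (i, if i \<in> S then g j else j))"

definition wreath_maps :: "nat \<Rightarrow> (nat \<Rightarrow> nat) set \<Rightarrow> (nat \<Rightarrow> nat) set \<Rightarrow> (nat \<times> nat \<Rightarrow> nat \<times> nat) set" where
  "wreath_maps m S G = {wreath s g |s g. s \<in> S \<and> (\<forall>i<m. g i \<in> G) \<and> (\<forall>i\<ge>m. g i = id)}"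

lemma wreath_mapsI:
  "s \<in> S \<Longrightarrow> (\<And>i. i < m \<Longrightarrow> g i \<in> G) \<Longrightarrow> (\<And>i. m \<le> i \<Longrightarrow> g i = id) \<Longrightarrow> f = wreath s g
    \<Longrightarrow> f \<in> wreath_maps m S G"
  unfolding wreath_maps_def by blast

lemma top_map_comp: "top_map s \<circ> top_map s' = top_map (s \<circ> s')"
  by (auto simp: top_map_def fun_eq_iff)

lemma top_map_id [simp]: "top_map id = id"
  by (auto simp: top_map_def fun_eq_iff)

lemma top_map_funpow: "top_map s ^^ k = top_map (s ^^ k)"
  by (induction k) (simp_all only: funpow.simps top_map_comp top_map_id)

lemma base_map_comp: "base_map S g \<circ> base_map S g' = base_map S (g \<circ> g')"
  by (auto simp: base_map_def fun_eq_iff)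

lemma base_map_id [simp]: "base_map S id = id"
  by (auto simp: base_map_def fun_eq_iff)

lemma base_map_funpow: "base_map S g ^^ k = base_map S (g ^^ k)"
  by (induction k) (simp_all only: funpow.simps base_map_comp base_map_id)

lemma base_map_disjoint_comp:
  "S \<inter> S' = {} \<Longrightarrow> base_map S g \<circ> base_map S' g = base_map (S \<union> S') g"
  by (auto simp: base_map_def fun_eq_iff)

lemma base_map_diff_comp:
  "S \<subseteq> S' \<Longrightarrow> g \<circ> g = id \<Longrightarrow> base_map S g \<circ> base_map S' g = base_map (S' - S) g"
  by (auto simp: base_map_def fun_eq_iff)

lemma top_map_base_map:
  assumes "inj s"
  shows "top_map s \<circ> base_map S g = base_map (s ` S) g \<circ> top_map s"
  using assms by (auto simp: top_map_def base_map_def fun_eq_iff inj_image_mem_iff)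

lemma comp_closed_top: "comp_closed H \<Longrightarrow> comp_closed {s. top_map s \<in> H}"
  by (auto simp: comp_closed_def simp flip: top_map_comp)

lemma comp_closed_base: "comp_closed H \<Longrightarrow> comp_closed {g. base_map S g \<in> H}"
  by (auto simp: comp_closed_def simp flip: base_map_comp)

lemma comp_closed_self_maps: "comp_closed (self_maps k)"
  by (auto simp: comp_closed_def self_maps_def)

lemma comp_closed_perms: "comp_closed (perms k)"
  by (auto simp: comp_closed_def permutes_compose permutes_id)

lemma comp_closed_wreath_maps:
  assumes S: "comp_closed S" "S \<subseteq> self_maps m" and G: "comp_closed G"
  shows "comp_closed (wreath_maps m S G)"
proof -
  have "id \<in> wreath_maps m S G"
    using S G by (intro wreath_mapsI[of id _ _ "\<lambda>_. id"]) (auto simp: comp_closed_def wreath_def)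
  moreover have "f \<circ> f' \<in> wreath_maps m S G" if ff: "f \<in> wreath_maps m S G" "f' \<in> wreath_maps m S G" for f f'
  proof -
    obtain s g s' g' where w: "f = wreath s g" "f' = wreath s' g'" "s \<in> S" "s' \<in> S"
      "\<forall>i<m. g i \<in> G \<and> g' i \<in> G" "\<forall>i\<ge>m. g i = id \<and> g' i = id"
      using ff unfolding wreath_maps_def by blast
    have s': "i < m \<Longrightarrow> s' i < m" "m \<le> i \<Longrightarrow> s' i = i" for i
      using w(4) S(2) by (auto simp: self_maps_def)
    show ?thesis
    proof (rule wreath_mapsI)
      show "s \<circ> s' \<in> S" using w S by (auto intro: comp_closed_comp)
      show "g (s' i) \<circ> g' i \<in> G" if "i < m" for i
        using that w s' G by (intro comp_closed_comp) auto
      show "g (s' i) \<circ> g' i = id" if "m \<le> i" for i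
        using that w s' by simp
      show "f \<circ> f' = wreath (s \<circ> s') (\<lambda>i. g (s' i) \<circ> g' i)"
        by (auto simp: w(1,2) wreath_def fun_eq_iff)
    qed
  qed
  ultimately show ?thesis by (simp add: comp_closed_def)
qed

lemma top_map_in_wreath_maps: "s \<in> S \<Longrightarrow> comp_closed G \<Longrightarrow> top_map s \<in> wreath_maps m S G"
  by (rule wreath_mapsI[of s _ _ "\<lambda>_. id"]) (auto simp: comp_closed_def wreath_def top_map_def)

lemma base_map_in_wreath_maps:
  "I \<subseteq> {..<m} \<Longrightarrow> g \<in> G \<Longrightarrow> comp_closed S \<Longrightarrow> comp_closed G \<Longrightarrow> base_map I g \<in> wreath_maps m S G"
  by (rule wreath_mapsI[of id _ _ "\<lambda>i. if i \<in> I then g else id"])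
    (auto simp: comp_closed_def wreath_def base_map_def)

text \<open>
  Conjugating by the block transposition \<open>(0 i)\<close> carries a fibre map from block \<open>0\<close> to block \<open>i\<close>;
  a wreath map is the product of its fibre maps, one block at a time, followed by its top map.
\<close>

lemma wreath_maps_generated:
  assumes H: "comp_closed H" and m: "m > 0" and S: "perms m \<subseteq> S" "\<And>s. s \<in> S \<Longrightarrow> top_map s \<in> H"
    and G: "\<And>g. g \<in> G \<Longrightarrow> base_map {0} g \<in> H"
  shows "wreath_maps m S G \<subseteq> H"
proof
  fix f assume "f \<in> wreath_maps m S G"
  then obtain s g where f: "f = wreath s g" and s: "s \<in> S" and g: "\<forall>i<m. g i \<in> G" "\<forall>i\<ge>m. g i = id"
    by (auto simp: wreath_maps_def)
  have at: "base_map {i} (g i) \<in> H" if "i < m" for i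
  proof -
    have "top_map (swap 0 i) \<in> H" using that m S transpose_in_perms by blast
    moreover have "base_map {0} (g i) \<in> H" using that g(1) G by blast
    moreover have "top_map (swap 0 i) \<circ> base_map {0} (g i) \<circ> top_map (swap 0 i) = base_map {i} (g i)"
      by (simp add: top_map_base_map comp_assoc top_map_comp)
    ultimately show ?thesis using H by (metis comp_closed_comp)
  qed
  have below: "(\<lambda>(i, j). (i, if i < k then g i j else j)) \<in> H" if "k \<le> m" for k
    using that
  proof (induction k)
    case 0
    then show ?case using H by (simp add: comp_closed_def case_prod_unfold id_def)
  next
    case (Suc k)
    have "(\<lambda>(i, j). (i, if i < Suc k then g i j else j))
        = base_map {k} (g k) \<circ> (\<lambda>(i, j). (i, if i < k then g i j else j))"
      by (auto simp: base_map_def fun_eq_iff less_Suc_eq)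
    moreover have "\<dots> \<in> H" using Suc by (intro comp_closed_comp[OF H at]) auto
    ultimately show ?case by (simp only:)
  qed
  have "f = top_map s \<circ> (\<lambda>(i, j). (i, if i < m then g i j else j))"
    using g(2) by (auto simp: f wreath_def top_map_def fun_eq_iff not_less)
  then show "f \<in> H"
    using comp_closed_comp[OF H S(2)[OF s] below[OF order_refl]] by simp
qed

section \<open>Two generators of the wreath product of symmetric groups\<close>

abbreviation swap01 :: "nat \<Rightarrow> nat" where "swap01 \<equiv> swap 0 1"

text \<open>
  For even \<open>m\<close> both generators are products of two commuting maps of coprime orders: the odd cycle
  of blocks fixes block \<open>0\<close>, where the transposition acts, and the odd cycle of points acts in all
  blocks, which commutes with every block permutation.

  For odd \<open>m\<close> the cycle moves all blocks. The transposition is placed in block \<open>m - 1\<close>, the last one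
  before the cycle wraps around, so that the power \<open>m\<close> of the first generator acts by the
  transposition once in every block. In the second generator, \<open>(0 1)\<close> on the blocks is twisted by
  a transposition in block \<open>0\<close>; this has order \<open>4\<close> and commutes with the odd cycle of points in
  block \<open>2\<close>.
\<close>

definition unit_gen1 :: "nat \<Rightarrow> nat \<times> nat \<Rightarrow> nat \<times> nat" where
  "unit_gen1 m = top_map (odd_cycle m) \<circ> base_map {if even m then 0 else m - 1} swap01"

definition unit_gen2 :: "nat \<Rightarrow> nat \<Rightarrow> nat \<times> nat \<Rightarrow> nat \<times> nat" where
  "unit_gen2 m n = (if even m then top_map swap01 \<circ> base_map {..<m} (odd_cycle n)
     else (top_map swap01 \<circ> base_map {0} swap01) \<circ> base_map {2} (odd_cycle n))"

text \<open>
  Here the cycle itself is available, and its inverse is one of its powers.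
\<close>

lemma top_perms_generated:
  assumes H: "comp_closed H" and m: "m \<ge> 2"
    and "top_map swap01 \<in> H" "top_map (odd_cycle m) \<in> H" "s \<in> perms m"
  shows "top_map s \<in> H"
proof -
  let ?A = "{s. top_map s \<in> H}"
  have A: "comp_closed ?A" by (rule comp_closed_top[OF H])
  have "odd_cycle m \<circ> f \<circ> inv_into UNIV (odd_cycle m) \<in> ?A" if "f \<in> ?A" for f
    using comp_closed_inv[OF A _ odd_cycle_order odd_order_pos[OF m]] that assms(4)
    by (intro comp_closed_comp[OF A]) auto
  then have "perms m \<subseteq> ?A"
    using assms(3) by (intro perms_generated m A) auto
  then show ?thesis using assms(5) by auto
qed

lemma base_perms_generated:
  assumes H: "comp_closed H" and n: "n \<ge> 2" and S: "0 \<in> S"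
    and "base_map {0} swap01 \<in> H" and d: "base_map S (odd_cycle n) \<in> H" and "g \<in> perms n"
  shows "base_map {0} g \<in> H"
proof -
  let ?A = "{g. base_map {0} g \<in> H}" and ?d = "odd_cycle n"
  have A: "comp_closed ?A" by (rule comp_closed_base[OF H])
  have d': "base_map S (inv_into UNIV ?d) \<in> H"
    using comp_closed_inv[OF comp_closed_base[OF H] _ odd_cycle_order odd_order_pos[OF n], of S] d
    by auto
  have "?d \<circ> f \<circ> inv_into UNIV ?d \<in> ?A" if "f \<in> ?A" for f
  proof -
    have "base_map S ?d \<circ> base_map {0} f \<circ> base_map S (inv_into UNIV ?d)
        = base_map {0} (?d \<circ> f \<circ> inv_into UNIV ?d)"
      using S surj_f_inv_f[OF bij_is_surj[OF odd_cycle_bij[OF n]]]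
      by (auto simp: base_map_def fun_eq_iff)
    then show ?thesis using that d d' H by simp (metis comp_closed_comp)
  qed
  then have "perms n \<subseteq> ?A"
    using assms(4) by (intro perms_generated n A) auto
  then show ?thesis using assms(6) by auto
qed

lemma odd_gt_2: "m \<ge> 2 \<Longrightarrow> odd m \<Longrightarrow> 2 < m" for m :: nat
  by (cases "m = 2") auto

lemma swap01_image: "m \<ge> 2 \<Longrightarrow> swap01 ` {..<m} = {..<m}"
  by (intro permutes_image) (simp add: permutes_swap_id)

text \<open>
  Both generators split into their factors because an odd order is coprime to \<open>2\<close>.
\<close>

lemma units_generated_even:
  assumes H: "comp_closed H" and m: "m \<ge> 2" "even m" and n: "n \<ge> 2"
    and x: "unit_gen1 m \<in> H" and y: "unit_gen2 m n \<in> H"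
  shows "top_map swap01 \<in> H" "top_map (odd_cycle m) \<in> H"
    "base_map {0} swap01 \<in> H" "base_map {..<m} (odd_cycle n) \<in> H"
proof -
  have tt: "swap01 ^^ 2 = id" by (simp add: numeral_2_eq_2)
  have bD: "inj (odd_cycle m)" using odd_cycle_bij[OF m(1)] by (rule bij_is_inj)
  have "top_map (odd_cycle m) \<circ> base_map {0} swap01 = base_map {0} swap01 \<circ> top_map (odd_cycle m)"
    by (simp add: top_map_base_map[OF bD] odd_cycle_even_zero m(2))
  from coprime_orders_factors[OF H _ this, of "m - odd_start m" 2]
  show "top_map (odd_cycle m) \<in> H" "base_map {0} swap01 \<in> H"
    using x m odd_order[OF m(1)] odd_order_pos[OF m(1)] tt
    by (auto simp: unit_gen1_def top_map_funpow base_map_funpow odd_cycle_order)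
  have "top_map swap01 \<circ> base_map {..<m} (odd_cycle n) = base_map {..<m} (odd_cycle n) \<circ> top_map swap01"
    using swap01_image[OF m(1)] by (simp only: top_map_base_map[OF inj_transpose])
  from coprime_orders_factors[OF H _ this, of 2 "n - odd_start n"]
  show "top_map swap01 \<in> H" "base_map {..<m} (odd_cycle n) \<in> H"
    using y m odd_order[OF n] odd_order_pos[OF n] tt
    by (auto simp: unit_gen2_def top_map_funpow base_map_funpow odd_cycle_order)
qed

text \<open>
  After \<open>k\<close> steps a point of block \<open>a\<close> has wrapped around \<open>(a + k) div m\<close> times, and is hit by the
  transposition at each wrap.
\<close>

lemma unit_gen1_funpow:
  assumes m: "odd m" "a < m"
  shows "(unit_gen1 m ^^ k) (a, b) = ((a + k) mod m, (swap01 ^^ ((a + k) div m)) b)"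
proof (induction k)
  case (Suc k)
  have step: "unit_gen1 m (p, q) = (Suc p mod m, if Suc p = m then swap01 q else q)" if "p < m" for p q
    using that m(1)
    by (auto simp: unit_gen1_def top_map_def base_map_def odd_cycle_def odd_start_def)
  have "(a + k) mod m < m" using m by simp
  from step[OF this] show ?case
    by (cases "Suc ((a + k) mod m) = m") (simp_all add: Suc mod_Suc_eq div_Suc mod_Suc)
qed (use m in simp)

text \<open>
  Write \<open>t\<^sub>S\<close> for the transposition acting in the blocks of \<open>S\<close>. The first generator \<open>x\<close> yields
  \<open>x\<^sup>m = t\<^bsub>{..<m}\<^esub>\<close>. The second splits, since \<open>4\<close> is coprime to an odd order, into \<open>z\<close> and a cycle of
  points in block \<open>2\<close>, and \<open>z\<^sup>2 = t\<^bsub>{0, 1}\<^esub>\<close>. Conjugation by \<open>x\<close> moves this pair of blocks along, and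
  as \<open>m - 1\<close> is even, disjoint pairs fill \<open>{..<m - 1}\<close>. Comparison with \<open>x\<^sup>m\<close> leaves the transposition
  in block \<open>m - 1\<close> alone, which strips the twists off \<open>x\<close> and \<open>z\<close>.
\<close>

lemma units_generated_odd:
  assumes H: "comp_closed H" and m: "m \<ge> 2" "odd m" and n: "n \<ge> 2"
    and x: "unit_gen1 m \<in> H" and y: "unit_gen2 m n \<in> H"
  shows "top_map swap01 \<in> H" "top_map (odd_cycle m) \<in> H"
    "base_map {0} swap01 \<in> H" "base_map {2} (odd_cycle n) \<in> H"
proof -
  let ?D = "odd_cycle m" and ?x = "unit_gen1 m" and ?z = "top_map swap01 \<circ> base_map {0} swap01"
  note HH = comp_closed_comp[OF H]
  have x_def: "?x = top_map ?D \<circ> base_map {m - 1} swap01"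
    using m by (simp add: unit_gen1_def)
  have injD: "inj ?D" using odd_cycle_bij[OF m(1)] by (rule bij_is_inj)
  have r: "odd_start m = 0" using m by (simp add: odd_start_def)
  have DSuc: "?D a = Suc a" if "Suc a < m" for a
    using odd_cycle_Suc[of m a] r that by simp
  have D_last: "?D (m - 1) = 0" using m by (simp add: odd_cycle_def r)
  have tt: "swap01 \<circ> swap01 = id" by simp
  have xm: "?x ^^ m = base_map {..<m} swap01"
  proof
    fix ab :: "nat \<times> nat"
    obtain a b where ab: "ab = (a, b)" by fastforce
    show "(?x ^^ m) ab = base_map {..<m} swap01 ab"
    proof (cases "a < m")
      case True
      then have "(a + m) div m = 1" by (simp add: div_add_self2)
      with True show ?thesis
        using unit_gen1_funpow[OF m(2) True, of m b] by (simp add: ab base_map_def)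
    next
      case False
      then have "?x (a, b) = (a, b)"
        using m by (simp add: x_def top_map_def base_map_def odd_cycle_outside)
      then have "(?x ^^ k) (a, b) = (a, b)" for k
        by (induction k) simp_all
      then show ?thesis using False by (simp add: ab base_map_def)
    qed
  qed
  then have all: "base_map {..<m} swap01 \<in> H"
    using comp_closed_funpow[OF H x] by metis
  have x_order: "?x ^^ (m * 2) = id"
    using tt by (simp only: funpow_mult[symmetric] xm base_map_funpow) (simp add: numeral_2_eq_2)
  have zz: "?z \<circ> ?z = base_map {0, 1} swap01"
    by (auto simp: fun_eq_iff top_map_def base_map_def Transposition.transpose_def)
  have "?z \<circ> base_map {2} (odd_cycle n) = base_map {2} (odd_cycle n) \<circ> ?z"
    by (auto simp: fun_eq_iff top_map_def base_map_def Transposition.transpose_def)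
  moreover have "?z ^^ 4 = id"
  proof -
    have "?z ^^ 4 = (?z \<circ> ?z) \<circ> (?z \<circ> ?z)"
      by (simp add: eval_nat_numeral comp_assoc)
    also have "\<dots> = id" unfolding zz using tt by (simp add: base_map_comp)
    finally show ?thesis .
  qed
  moreover have "coprime 4 (n - odd_start n)"
    using odd_order[OF n] coprime_power_left_iff[of 2 2 "n - odd_start n"] by simp
  ultimately have z: "?z \<in> H" and d: "base_map {2} (odd_cycle n) \<in> H"
    using coprime_orders_factors[OF H, of ?z "base_map {2} (odd_cycle n)" 4 "n - odd_start n"]
      y m odd_order_pos[OF n]
    by (auto simp: unit_gen2_def base_map_funpow odd_cycle_order)
  show "base_map {2} (odd_cycle n) \<in> H" by (fact d)
  have conj: "base_map (?D ` S) swap01 \<in> H" if "base_map S swap01 \<in> H" for S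
  proof -
    have "?x \<circ> base_map S swap01 = base_map (?D ` S) swap01 \<circ> ?x"
      using injD by (auto simp: x_def fun_eq_iff top_map_def base_map_def inj_image_mem_iff)
    then have "?x \<circ> base_map S swap01 \<circ> inv_into UNIV ?x = base_map (?D ` S) swap01 \<circ> (?x \<circ> inv_into UNIV ?x)"
      by (simp add: comp_assoc)
    also have "?x \<circ> inv_into UNIV ?x = id"
      using finite_order_inv(1)[OF x_order] m(1) by (simp only: bij_is_surj flip: surj_iff)
    also have "base_map (?D ` S) swap01 \<circ> id = base_map (?D ` S) swap01" by (rule comp_id)
    finally have "?x \<circ> base_map S swap01 \<circ> inv_into UNIV ?x = base_map (?D ` S) swap01" .
    moreover have "?x \<circ> base_map S swap01 \<circ> inv_into UNIV ?x \<in> H"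
      using m(1) by (intro HH x that comp_closed_inv[OF H x x_order]) simp
    ultimately show ?thesis by (simp only:)
  qed
  have pair: "base_map {a, Suc a} swap01 \<in> H" if "Suc a < m" for a
    using that
  proof (induction a)
    case 0
    show ?case using HH[OF z z] zz by simp
  next
    case (Suc a)
    then have "base_map (?D ` {a, Suc a}) swap01 \<in> H" by (intro conj) simp
    then show ?case using Suc.prems by (simp add: DSuc)
  qed
  have initial: "base_map {..<2 * i} swap01 \<in> H" if "2 * i < m" for i
    using that
  proof (induction i)
    case 0
    show ?case using H by (simp add: base_map_def comp_closed_def case_prod_unfold id_def)
  next
    case (Suc i)
    have "base_map {..<2 * i} swap01 \<circ> base_map {2 * i, Suc (2 * i)} swap01 = base_map {..<2 * Suc i} swap01"
      by (subst base_map_disjoint_comp) (auto intro: arg_cong2[of _ _ _ _ base_map])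
    moreover have "base_map {..<2 * i} swap01 \<circ> base_map {2 * i, Suc (2 * i)} swap01 \<in> H"
      using Suc by (intro HH pair Suc.IH) auto
    ultimately show ?case by (simp only:)
  qed
  have "base_map {..<m - 1} swap01 \<in> H"
    using initial[of "m div 2"] m by (simp add: odd_two_times_div_two_nat)
  then have "base_map {..<m - 1} swap01 \<circ> base_map {..<m} swap01 \<in> H" using all by (rule HH)
  moreover have "{..<m} - {..<m - 1} = {m - 1}" using m by auto
  moreover have "base_map {..<m - 1} swap01 \<circ> base_map {..<m} swap01 = base_map ({..<m} - {..<m - 1}) swap01"
    by (intro base_map_diff_comp tt) auto
  ultimately have last: "base_map {m - 1} swap01 \<in> H" by (simp only:)
  have "base_map (?D ` {m - 1}) swap01 \<in> H" by (rule conj[OF last])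
  then show 0: "base_map {0} swap01 \<in> H" using D_last by simp
  have "?x \<circ> base_map {m - 1} swap01 = top_map ?D"
    unfolding x_def comp_assoc base_map_comp tt by simp
  then show "top_map ?D \<in> H" using HH[OF x last] by simp
  have "?z \<circ> base_map {0} swap01 = top_map swap01"
    unfolding comp_assoc base_map_comp tt by simp
  then show "top_map swap01 \<in> H" using HH[OF z 0] by simp
qed

text \<open>
  In both cases an odd cycle of points acts on a set of blocks containing \<open>0\<close> (for odd \<open>m\<close>, after
  moving it from block \<open>2\<close>). On block \<open>0\<close> it has the same conjugation action as the cycle in
  that block alone.
\<close>

lemma units_generated:
  assumes H: "comp_closed H" and m: "m \<ge> 2" and n: "n \<ge> 2"
    and x: "unit_gen1 m \<in> H" and y: "unit_gen2 m n \<in> H"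
  shows "s \<in> perms m \<Longrightarrow> top_map s \<in> H" "g \<in> perms n \<Longrightarrow> base_map {0} g \<in> H"
proof -
  have t: "top_map swap01 \<in> H" "top_map (odd_cycle m) \<in> H" "base_map {0} swap01 \<in> H"
    using units_generated_even[OF H m _ n x y] units_generated_odd[OF H m _ n x y] by blast+
  show top: "top_map s \<in> H" if "s \<in> perms m" for s
    using top_perms_generated[OF H m t(1,2) that] .
  have "\<exists>S. 0 \<in> S \<and> base_map S (odd_cycle n) \<in> H"
  proof (cases "even m")
    case True
    then show ?thesis using units_generated_even(4)[OF H m _ n x y] m by (intro exI[of _ "{..<m}"]) auto
  next
    case False
    have "top_map (swap 0 2) \<in> H" using odd_gt_2[OF m False] by (intro top transpose_in_perms) auto
    moreover have "base_map {2} (odd_cycle n) \<in> H"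
      using units_generated_odd(4)[OF H m False n x y] .
    moreover have "top_map (swap 0 2) \<circ> base_map {2} (odd_cycle n) \<circ> top_map (swap 0 2) = base_map {0} (odd_cycle n)"
      by (simp add: top_map_base_map comp_assoc top_map_comp)
    ultimately have "base_map {0} (odd_cycle n) \<in> H" using H by (metis comp_closed_comp)
    then show ?thesis by blast
  qed
  then show "base_map {0} g \<in> H" if "g \<in> perms n"
    using base_perms_generated[OF H n _ t(3) _ that] by blast
qed

lemma unit_gens_in_wreath_maps:
  assumes m: "m \<ge> 2" and n: "n \<ge> 2"
  shows "unit_gen1 m \<in> wreath_maps m (perms m) (perms n)"
    "unit_gen2 m n \<in> wreath_maps m (perms m) (perms n)"
proof -
  note W = comp_closed_comp[OF comp_closed_wreath_maps[OF comp_closed_perms perms_subset_self_maps comp_closed_perms]]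
  have odd: "2 < m" if "odd m" using odd_gt_2[OF m that] .
  have t: "swap01 \<in> perms k" if "k \<ge> 2" for k using that by (intro transpose_in_perms) auto
  note B = base_map_in_wreath_maps[OF _ _ comp_closed_perms comp_closed_perms]
    top_map_in_wreath_maps[OF _ comp_closed_perms]
  show "unit_gen1 m \<in> wreath_maps m (perms m) (perms n)"
    unfolding unit_gen1_def using m n t odd_cycle_in_perms by (intro W B) auto
  show "unit_gen2 m n \<in> wreath_maps m (perms m) (perms n)"
    unfolding unit_gen2_def using m n t odd_cycle_in_perms odd by (auto intro!: W B)
qed

lemma wreath_maps_generated_by:
  assumes H: "comp_closed H" and m: "m \<ge> 2" and n: "n \<ge> 2"
    and x: "unit_gen1 m \<in> H" and y: "unit_gen2 m n \<in> H"
  shows "top_map collapse \<in> H \<Longrightarrow> wreath_maps m (self_maps m) (perms n) \<subseteq> H"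
    and "base_map {0} collapse \<in> H \<Longrightarrow> wreath_maps m (perms m) (self_maps n) \<subseteq> H"
    and "top_map collapse \<in> H \<Longrightarrow> base_map {0} collapse \<in> H \<Longrightarrow>
      wreath_maps m (self_maps m) (self_maps n) \<subseteq> H"
proof -
  have m0: "m > 0" using m by simp
  note U = units_generated[OF H m n x y]
  have top: "top_map s \<in> H" if "top_map collapse \<in> H" "s \<in> self_maps m" for s
    using self_maps_generated[OF comp_closed_top[OF H] m] U(1) that by auto
  have base: "base_map {0} g \<in> H" if "base_map {0} collapse \<in> H" "g \<in> self_maps n" for g
    using self_maps_generated[OF comp_closed_base[OF H] n] U(2) that by auto
  note gen = wreath_maps_generated[OF H m0]
  show "top_map collapse \<in> H \<Longrightarrow> wreath_maps m (self_maps m) (perms n) \<subseteq> H"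
    by (rule gen[OF perms_subset_self_maps top U(2)])
  show "base_map {0} collapse \<in> H \<Longrightarrow> wreath_maps m (perms m) (self_maps n) \<subseteq> H"
    by (rule gen[OF order_refl U(1) base])
  show "top_map collapse \<in> H \<Longrightarrow> base_map {0} collapse \<in> H \<Longrightarrow>
      wreath_maps m (self_maps m) (self_maps n) \<subseteq> H"
    by (rule gen[OF perms_subset_self_maps top base])
qed

section \<open>Words and factor-closed submonoids\<close>

lemma word_value_Nil [simp]: "word_value M [] = one M"
  by (simp add: word_value_def)

lemma word_value_Cons [simp]: "word_value M (u # w) = u \<otimes>\<^bsub>M\<^esub> word_value M w"
  by (simp add: word_value_def)

lemma word_value_closed:
  "monoid M \<Longrightarrow> w \<in> lists (carrier M) \<Longrightarrow> word_value M w \<in> carrier M"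
  by (induction w) (auto intro: monoid.m_closed)

lemma word_value_append:
  assumes "monoid M" "v \<in> lists (carrier M)" "w \<in> lists (carrier M)"
  shows "word_value M (v @ w) = word_value M v \<otimes>\<^bsub>M\<^esub> word_value M w"
  using assms(2)
proof (induction v)
  case (Cons u v)
  then show ?case
    using word_value_closed[OF assms(1)] assms by (simp add: monoid.m_assoc)
next
  case Nil
  show ?case using monoid.l_one[OF assms(1) word_value_closed[OF assms(1,3)]] by simp
qed

text \<open>
  The word values form the least submonoid containing \<open>U\<close>, so words can be avoided when generation
  is to be established.
\<close>

lemma generatesI:
  assumes M: "monoid M" and U: "U \<subseteq> carrier M"
    and min: "\<And>H. submonoid H M \<Longrightarrow> U \<subseteq> H \<Longrightarrow> carrier M \<subseteq> H"
  shows "generates M U"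
proof -
  let ?H = "word_value M ` lists U"
  have sub: "lists U \<subseteq> lists (carrier M)" using U by (rule lists_mono)
  have "submonoid ?H M"
  proof
    show "?H \<subseteq> carrier M" using word_value_closed[OF M] sub by blast
    have "word_value M [] \<in> ?H" by (intro imageI) simp
    then show "\<one>\<^bsub>M\<^esub> \<in> ?H" by simp
    fix x y assume "x \<in> ?H" "y \<in> ?H"
    then obtain v w where vw: "v \<in> lists U" "w \<in> lists U" "x = word_value M v" "y = word_value M w"
      by blast
    have "v \<in> lists (carrier M)" "w \<in> lists (carrier M)" using vw sub by blast+
    then have "x \<otimes>\<^bsub>M\<^esub> y = word_value M (v @ w)"
      unfolding vw(3,4) by (rule word_value_append[OF M, symmetric])
    moreover have "v @ w \<in> lists U" using vw by simp
    ultimately show "x \<otimes>\<^bsub>M\<^esub> y \<in> ?H" by (metis imageI)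
  qed
  moreover have "U \<subseteq> ?H"
  proof
    fix u assume u: "u \<in> U"
    then have "word_value M [u] = u" using U M by (auto simp: monoid.r_one)
    moreover have "[u] \<in> lists U" using u by simp
    ultimately show "u \<in> ?H" by (metis imageI)
  qed
  ultimately have "carrier M \<subseteq> ?H" by (rule min)
  then show ?thesis using U unfolding generates_def by blast
qed

text \<open>
  For a finite monoid, these are the submonoids whose complement is empty or a completely prime
  ideal; the group of units is the least one.
\<close>

definition factor_closed :: "('a, 'b) monoid_scheme \<Rightarrow> 'a set \<Rightarrow> bool" where
  "factor_closed M G \<longleftrightarrow> submonoid G M \<and>
     (\<forall>x\<in>carrier M. \<forall>y\<in>carrier M. x \<otimes>\<^bsub>M\<^esub> y \<in> G \<longrightarrow> x \<in> G \<and> y \<in> G)"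

lemma factor_closed_carrier: "monoid M \<Longrightarrow> factor_closed M (carrier M)"
  by (auto simp: factor_closed_def submonoid_def monoid.m_closed monoid.one_closed)

text \<open>
  If the value of a word lies in \<open>G\<close>, then so does every letter.
\<close>

lemma factor_closed_words:
  assumes M: "monoid M" and G: "factor_closed M G" and U: "generates M U" and "s \<in> G"
  shows "\<exists>w\<in>lists (U \<inter> G). word_value M w = s"
proof -
  have "s \<in> carrier M" using G \<open>s \<in> G\<close> by (auto simp: factor_closed_def submonoid_def)
  with U have "\<exists>w\<in>lists U. word_value M w = s" by (simp only: generates_def)
  then obtain w where w: "w \<in> lists U" "word_value M w = s" by (elim bexE)
  have UM: "U \<subseteq> carrier M" using U by (simp add: generates_def)
  have "w \<in> lists (U \<inter> G)" if "w \<in> lists U" "word_value M w \<in> G" for w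
    using that
  proof (induction rule: lists.induct)
    case (Cons u w)
    have "w \<in> lists (carrier M)" "u \<in> carrier M"
      using subsetD[OF lists_mono[OF UM] Cons.hyps(2)] Cons.hyps(1) UM by auto
    then have "word_value M w \<in> G" "u \<in> G"
      using Cons.prems G word_value_closed[OF M] unfolding factor_closed_def by auto
    then show ?case using Cons by auto
  qed simp
  then show ?thesis using w \<open>s \<in> G\<close> by blast
qed

text \<open>
  A strict inclusion of \<open>G\<close> in \<open>K\<close> costs a generator: words over generators from \<open>G\<close> never leave
  \<open>G\<close>.
\<close>

lemma generator_outside_factor_closed:
  assumes M: "monoid M" and G: "submonoid G M" and K: "factor_closed M K"
    and U: "generates M U" and s: "s \<in> K" "s \<notin> G"
  shows "\<exists>u. u \<in> U \<and> u \<in> K \<and> u \<notin> G"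
proof (rule ccontr)
  assume "\<not> ?thesis"
  then have sub: "U \<inter> K \<subseteq> G" by blast
  obtain w where w: "w \<in> lists (U \<inter> K)" "word_value M w = s"
    using factor_closed_words[OF M K U s(1)] by blast
  have "word_value M v \<in> G" if "v \<in> lists (U \<inter> K)" for v
    using that
  proof (induction v)
    case Nil
    then show ?case using G by (simp add: submonoid.one_closed)
  next
    case (Cons u v)
    then show ?case using G sub by (auto intro: submonoid.m_closed)
  qed
  then show False using w s(2) by blast
qed

text \<open>
  With a single generator in \<open>G\<close>, all elements of \<open>G\<close> would be powers of it and commute.
\<close>

lemma two_generators_of_noncommuting:
  assumes M: "monoid M" and G: "factor_closed M G" and U: "generates M U"
    and st: "s \<in> G" "t \<in> G" "s \<otimes>\<^bsub>M\<^esub> t \<noteq> t \<otimes>\<^bsub>M\<^esub> s"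
  shows "\<exists>u v. u \<noteq> v \<and> u \<in> U \<and> v \<in> U \<and> u \<in> G \<and> v \<in> G"
proof (rule ccontr)
  assume neg: "\<not> ?thesis"
  obtain v w where vw: "v \<in> lists (U \<inter> G)" "word_value M v = s" "w \<in> lists (U \<inter> G)" "word_value M w = t"
    using factor_closed_words[OF M G U] st by metis
  have UM: "U \<subseteq> carrier M" using U by (simp add: generates_def)
  have "v @ w = w @ v"
  proof (cases "U \<inter> G = {}")
    case True
    then show ?thesis using vw by simp
  next
    case False
    then obtain u where "U \<inter> G \<subseteq> {u}" using neg by blast
    then have "replicate (length v) u = v" "replicate (length w) u = w"
      using vw(1,3) by (auto intro!: replicate_eqI[symmetric])
    then show ?thesis by (metis add.commute replicate_add)
  qed
  moreover have "v \<in> lists (carrier M)" "w \<in> lists (carrier M)" using vw UM by auto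
  ultimately show False using word_value_append[OF M] vw(2,4) st(3) by metis
qed

lemma factor_closed_Int:
  "factor_closed M G \<Longrightarrow> factor_closed M K \<Longrightarrow> factor_closed M (G \<inter> K)"
  unfolding factor_closed_def submonoid_def by (intro conjI; blast)

lemma mult_submonoid: "f \<otimes>\<^bsub>full_transformation_monoid X\<lparr>carrier := C\<rparr>\<^esub> g = compose X g f"
  by (simp add: full_transformation_monoid_def)

text \<open>
  If a composition is injective, then so is the map applied first; on a finite set that map is onto,
  so the second one is injective on all of \<open>X\<close>.
\<close>

lemma factor_closed_injective:
  assumes fin: "finite X" and C: "submonoid C (full_transformation_monoid X)"
  shows "factor_closed (full_transformation_monoid X\<lparr>carrier := C\<rparr>) {f \<in> C. inj_on f X}"
    (is "factor_closed ?M ?G")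
proof -
  have maps: "f ` X \<subseteq> X" if "f \<in> C" for f
    using that submonoid.subset[OF C] by (auto simp: full_transformation_monoid_def)
  have mult: "f \<otimes>\<^bsub>?M\<^esub> g = compose X g f" for f g by (rule mult_submonoid)
  have onto: "f ` X = X" if "f \<in> C" "inj_on f X" for f
    using endo_inj_surj[OF fin maps that(2)] that(1) by simp
  have inj_compose: "inj_on (compose X g f) X \<longleftrightarrow> inj_on f X \<and> inj_on g X"
    if "f \<in> C" "g \<in> C" for f g
  proof -
    have "inj_on (compose X g f) X \<longleftrightarrow> inj_on (g \<circ> f) X"
      by (intro inj_on_cong) (simp add: compose_def)
    also have "\<dots> \<longleftrightarrow> inj_on f X \<and> inj_on g (f ` X)"
      using comp_inj_on[of f X g] inj_on_imageI[of g f X] inj_on_imageI2[of g f X] by argo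
    also have "\<dots> \<longleftrightarrow> inj_on f X \<and> inj_on g X" using onto[OF that(1)] by auto
    finally show ?thesis .
  qed
  have "submonoid ?G ?M"
  proof
    show "\<one>\<^bsub>?M\<^esub> \<in> ?G"
      using submonoid.one_closed[OF C] by (simp add: full_transformation_monoid_def inj_on_def)
    show "f \<otimes>\<^bsub>?M\<^esub> g \<in> ?G" if "f \<in> ?G" "g \<in> ?G" for f g
      using that inj_compose[of f g] submonoid.m_closed[OF C, of f g]
      by (simp add: full_transformation_monoid_def)
  qed auto
  moreover have "f \<in> ?G \<and> g \<in> ?G"
    if "f \<in> carrier ?M" "g \<in> carrier ?M" "f \<otimes>\<^bsub>?M\<^esub> g \<in> ?G" for f g
    using that inj_compose[of f g] unfolding mult by simp
  ultimately show ?thesis unfolding factor_closed_def by blast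
qed

lemma monoid_rank_eqI:
  assumes "generates M U" "finite U" "card U \<le> n"
    and lower: "\<And>V. generates M V \<Longrightarrow> finite V \<Longrightarrow> n \<le> card V"
  shows "monoid_rank M = n"
  unfolding monoid_rank_def
proof (rule Least_equality)
  show "\<exists>U. generates M U \<and> finite U \<and> card U = n"
    using assms by (metis le_antisym)
qed (use lower in blast)

section \<open>Coordinates of a uniform partition\<close>

text \<open>
  A numbering \<open>\<phi>\<close> of \<open>X\<close> under which the parts are the blocks \<open>{i} \<times> {..<n}\<close>.
\<close>

locale coordinates =
  fixes X :: "'a set" and \<P> :: "'a set set" and m n :: nat and \<phi> :: "nat \<times> nat \<Rightarrow> 'a"
  assumes bij: "bij_betw \<phi> ({..<m} \<times> {..<n}) X"
    and parts: "\<P> = (\<lambda>i. \<phi> ` ({i} \<times> {..<n})) ` {..<m}"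
    and m2: "m \<ge> 2" and n2: "n \<ge> 2"
begin

abbreviation box :: "(nat \<times> nat) set" where "box \<equiv> {..<m} \<times> {..<n}"

definition lift :: "(nat \<times> nat \<Rightarrow> nat \<times> nat) \<Rightarrow> 'a \<Rightarrow> 'a" where
  "lift F = (\<lambda>x\<in>X. \<phi> (F (inv_into box \<phi> x)))"

lemma inj: "inj_on \<phi> box" and range: "\<phi> ` box = X"
  using bij by (auto simp: bij_betw_def)

lemma phi_in: "p \<in> box \<Longrightarrow> \<phi> p \<in> X"
  using range by blast

lemma phi_eq: "p \<in> box \<Longrightarrow> q \<in> box \<Longrightarrow> \<phi> p = \<phi> q \<longleftrightarrow> p = q"
  using inj by (auto simp: inj_on_def)

lemma lift_phi: "p \<in> box \<Longrightarrow> lift F (\<phi> p) = \<phi> (F p)"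
  by (simp add: lift_def phi_in inj)

lemma ball_X: "(\<forall>x\<in>X. Q x) \<longleftrightarrow> (\<forall>i<m. \<forall>j<n. Q (\<phi> (i, j)))"
  using range by force

lemma eq_liftI:
  assumes "f \<in> extensional X" "\<And>i j. i < m \<Longrightarrow> j < n \<Longrightarrow> f (\<phi> (i, j)) = \<phi> (F (i, j))"
  shows "f = lift F"
proof (rule extensionalityI[of _ X])
  show "lift F \<in> extensional X" by (simp add: lift_def)
  have "\<forall>x\<in>X. f x = lift F x" unfolding ball_X using assms(2) lift_phi by auto
  then show "f x = lift F x" if "x \<in> X" for x using that by blast
qed (rule assms(1))

lemma compose_lift: "F \<in> box \<rightarrow> box \<Longrightarrow> compose X (lift G) (lift F) = lift (G \<circ> F)"
  by (rule eq_liftI) (auto simp: compose_def phi_in lift_phi Pi_iff)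

lemma lift_id: "(\<lambda>x\<in>X. x) = lift id"
  by (rule eq_liftI) (auto simp: phi_in)

lemma same_part_phi:
  assumes "i < m" "j < n" "i' < m" "j' < n"
  shows "same_part \<P> (\<phi> (i, j)) (\<phi> (i', j')) \<longleftrightarrow> i = i'"
proof -
  have "\<phi> (a, b) \<in> \<phi> ` ({k} \<times> {..<n}) \<longleftrightarrow> a = k" if "k < m" "a < m" "b < n" for a b k
    using that phi_eq by force
  then show ?thesis using assms unfolding same_part_def parts by auto
qed

lemma wreath_in_box: "s \<in> self_maps m \<Longrightarrow> \<forall>i<m. g i \<in> self_maps n \<Longrightarrow> wreath s g \<in> box \<rightarrow> box"
  by (auto simp: wreath_def self_maps_def)

lemma lift_wreath_in_T:
  assumes "s \<in> self_maps m" "\<forall>i<m. g i \<in> self_maps n"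
  shows "lift (wreath s g) \<in> T_maps X \<P>"
proof -
  have v: "s i < m" "g i j < n" if "i < m" "j < n" for i j
    using that assms by (auto simp: self_maps_def)
  have "lift (wreath s g) \<in> X \<rightarrow>\<^sub>E X"
  proof -
    have "inv_into box \<phi> x \<in> box" if "x \<in> X" for x
      using that unfolding range[symmetric] by (rule inv_into_into)
    then have "\<phi> (wreath s g (inv_into box \<phi> x)) \<in> X" if "x \<in> X" for x
      using that wreath_in_box[OF assms] by (blast intro: phi_in)
    then show ?thesis by (simp add: lift_def)
  qed
  then show ?thesis
    unfolding T_maps_def full_transformation_monoid_def ball_X
    using v by (auto simp: lift_phi wreath_def same_part_phi)
qed

text \<open>
  All points of block \<open>i\<close> are sent to the same block as the point \<open>(i, 0)\<close>, which serves to define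
  the top map.
\<close>

lemma T_maps_wreath:
  assumes f: "f \<in> T_maps X \<P>"
  obtains s g where "s \<in> self_maps m" "\<forall>i<m. g i \<in> self_maps n" "\<forall>i\<ge>m. g i = id"
    "f = lift (wreath s g)"
proof -
  let ?c = "\<lambda>i j. inv_into box \<phi> (f (\<phi> (i, j)))"
  define s where "s i = (if i < m then fst (?c i 0) else i)" for i
  define g where "g i j = (if i < m \<and> j < n then snd (?c i j) else j)" for i j
  have fE: "f \<in> X \<rightarrow>\<^sub>E X"
    using f by (auto simp: T_maps_def full_transformation_monoid_def)
  have c: "?c i j \<in> box" "\<phi> (?c i j) = f (\<phi> (i, j))" if "i < m" "j < n" for i j
  proof -
    have "f (\<phi> (i, j)) \<in> X" using fE phi_in[of "(i, j)"] that by auto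
    then show "?c i j \<in> box" "\<phi> (?c i j) = f (\<phi> (i, j))"
      unfolding range[symmetric] by (rule inv_into_into, rule f_inv_into_f)
  qed
  have fst_c: "fst (?c i j) = fst (?c i 0)" if ij: "i < m" "j < n" for i j
  proof -
    have z: "0 < n" using n2 by simp
    have "same_part \<P> (f (\<phi> (i, j))) (f (\<phi> (i, 0)))"
      using f ij z same_part_phi[of i j i 0] phi_in[of "(i, j)"] phi_in[of "(i, 0)"]
      unfolding T_maps_def by auto
    then have "same_part \<P> (\<phi> (fst (?c i j), snd (?c i j))) (\<phi> (fst (?c i 0), snd (?c i 0)))"
      using c(2) ij z by simp
    then show ?thesis
      using same_part_phi c(1)[OF ij] c(1)[OF ij(1) z] by (metis mem_Times_iff lessThan_iff)
  qed
  have eq: "\<phi> (s i, g i j) = f (\<phi> (i, j))" if "i < m" "j < n" for i j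
    using that c(2)[OF that] fst_c[OF that] by (simp add: s_def g_def flip: fst_c)
  show thesis
  proof (rule that)
    show "s \<in> self_maps m"
      using c(1)[of _ 0] n2 by (auto simp: self_maps_def s_def mem_Times_iff)
    show "\<forall>i<m. g i \<in> self_maps n"
      using c(1) by (auto simp: self_maps_def g_def mem_Times_iff)
    show "\<forall>i\<ge>m. g i = id" by (auto simp: g_def)
    show "f = lift (wreath s g)"
      using fE by (intro eq_liftI) (auto simp: eq wreath_def PiE_iff)
  qed
qed

lemma lift_wreath_in_Sigma_iff:
  assumes s: "s \<in> self_maps m" and g: "\<forall>i<m. g i \<in> self_maps n"
  shows "lift (wreath s g) \<in> Sigma_maps X \<P> \<longleftrightarrow> s permutes {..<m}"
proof -
  have v: "s i < m" "g i j < n" if "i < m" "j < n" for i j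
    using that s g by (auto simp: self_maps_def)
  have c: "lift (wreath s g) \<in> carrier (full_transformation_monoid X)"
    using lift_wreath_in_T[OF s g] by (simp add: T_maps_def)
  have "lift (wreath s g) \<in> Sigma_maps X \<P>
      \<longleftrightarrow> (\<forall>i<m. \<forall>j<n. \<forall>i'<m. \<forall>j'<n. i = i' \<longleftrightarrow> s i = s i')"
    unfolding Sigma_maps_def ball_X using c v by (simp add: lift_phi wreath_def same_part_phi)
  also have "\<dots> \<longleftrightarrow> inj_on s {..<m}"
  proof -
    have "\<exists>j. j < n" using n2 by (intro exI[of _ 0]) simp
    then show ?thesis unfolding inj_on_def by auto
  qed
  also have "\<dots> \<longleftrightarrow> s permutes {..<m}"
    using inj_self_map_permutes[OF s] permutes_inj inj_on_subset by blast
  finally show ?thesis .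
qed

text \<open>
  The image of block \<open>i\<close> meets only block \<open>s i\<close>, so the condition is that every fibre map is onto,
  hence a permutation.
\<close>

lemma lift_wreath_in_Gamma_iff:
  assumes s: "s \<in> self_maps m" and g: "\<forall>i<m. g i \<in> self_maps n"
  shows "lift (wreath s g) \<in> Gamma_maps X \<P> \<longleftrightarrow> (\<forall>i<m. g i permutes {..<n})"
proof -
  have v: "s i < m" "g i j < n" if "i < m" "j < n" for i j
    using that s g by (auto simp: self_maps_def)
  have im: "lift (wreath s g) ` \<phi> ` ({i} \<times> {..<n}) = \<phi> ` ({s i} \<times> g i ` {..<n})" if "i < m" for i
    using that lift_phi by (force simp: wreath_def image_iff)
  have meet: "\<phi> ` ({s i} \<times> g i ` {..<n}) \<inter> \<phi> ` ({k} \<times> {..<n}) = {} \<longleftrightarrow> s i \<noteq> k"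
    if "i < m" "k < m" for i k
  proof -
    have "{s i} \<times> g i ` {..<n} \<subseteq> box" "{k} \<times> {..<n} \<subseteq> box" using v that by auto
    from inj_on_image_Int[OF inj this]
    have "\<phi> ` ({s i} \<times> g i ` {..<n}) \<inter> \<phi> ` ({k} \<times> {..<n})
        = \<phi> ` (({s i} \<inter> {k}) \<times> (g i ` {..<n} \<inter> {..<n}))"
      by (simp only: Times_Int_Times)
    moreover have "g i 0 \<in> g i ` {..<n} \<inter> {..<n}" using v(2)[OF that(1), of 0] n2 by simp
    ultimately show ?thesis by (simp only: image_is_empty Times_empty) blast
  qed
  have cover: "\<phi> ` ({s i} \<times> g i ` {..<n}) = \<phi> ` ({s i} \<times> {..<n}) \<longleftrightarrow> g i permutes {..<n}"
    if "i < m" for i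
  proof -
    have "{s i} \<times> g i ` {..<n} \<subseteq> box" "{s i} \<times> {..<n} \<subseteq> box" using v that n2 by auto
    from inj_on_image_eq_iff[OF inj this]
    have "\<phi> ` ({s i} \<times> g i ` {..<n}) = \<phi> ` ({s i} \<times> {..<n}) \<longleftrightarrow> g i ` {..<n} = {..<n}"
      using n2 by (auto simp: times_eq_iff)
    also have "\<dots> \<longleftrightarrow> g i permutes {..<n}"
    proof
      assume "g i ` {..<n} = {..<n}"
      then have "inj_on (g i) {..<n}" by (intro eq_card_imp_inj_on) simp_all
      then show "g i permutes {..<n}" using g that by (intro inj_self_map_permutes) simp_all
    qed (rule permutes_image)
    finally show ?thesis .
  qed
  have "lift (wreath s g) \<in> Gamma_maps X \<P> \<longleftrightarrow> (\<forall>i\<in>{..<m}. \<forall>k\<in>{..<m}. s i \<noteq> k \<or>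
      \<phi> ` ({s i} \<times> g i ` {..<n}) = \<phi> ` ({k} \<times> {..<n}))"
    unfolding Gamma_maps_def using lift_wreath_in_T[OF s g]
    by (simp add: parts im meet)
  also have "\<dots> \<longleftrightarrow> (\<forall>i<m. g i permutes {..<n})"
  proof -
    have "s i < m" if "i < m" for i using v(1)[OF that, of 0] n2 by simp
    then show ?thesis using cover by fastforce
  qed
  finally show ?thesis .
qed

lemma perms_self_maps: "p permutes {..<k} \<Longrightarrow> p \<in> self_maps k"
  using perms_subset_self_maps by auto

lemma T_maps_eq: "T_maps X \<P> = lift ` wreath_maps m (self_maps m) (self_maps n)" (is "?L = ?R")
proof
  show "?L \<subseteq> ?R"
  proof
    fix f assume "f \<in> ?L"
    then show "f \<in> ?R"
    proof (rule T_maps_wreath)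
      fix s g assume *: "s \<in> self_maps m" "\<forall>i<m. g i \<in> self_maps n" "\<forall>i\<ge>m. g i = id"
        "f = lift (wreath s g)"
      then have "wreath s g \<in> wreath_maps m (self_maps m) (self_maps n)"
        by (intro wreath_mapsI) auto
      then show ?thesis using *(4) by blast
    qed
  qed
  show "?R \<subseteq> ?L" by (auto simp: wreath_maps_def intro!: lift_wreath_in_T)
qed

lemma Sigma_maps_eq: "Sigma_maps X \<P> = lift ` wreath_maps m (perms m) (self_maps n)" (is "?L = ?R")
proof
  show "?L \<subseteq> ?R"
  proof
    fix f assume f: "f \<in> ?L"
    then have "f \<in> T_maps X \<P>" by (simp add: Sigma_maps_def T_maps_def)
    then show "f \<in> ?R"
    proof (rule T_maps_wreath)
      fix s g assume *: "s \<in> self_maps m" "\<forall>i<m. g i \<in> self_maps n" "\<forall>i\<ge>m. g i = id"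
        "f = lift (wreath s g)"
      then have "wreath s g \<in> wreath_maps m (perms m) (self_maps n)"
        using f lift_wreath_in_Sigma_iff[OF *(1,2)] by (intro wreath_mapsI) auto
      then show ?thesis using *(4) by blast
    qed
  qed
  show "?R \<subseteq> ?L" by (auto simp: wreath_maps_def lift_wreath_in_Sigma_iff perms_self_maps)
qed

lemma Gamma_maps_eq: "Gamma_maps X \<P> = lift ` wreath_maps m (self_maps m) (perms n)" (is "?L = ?R")
proof
  show "?L \<subseteq> ?R"
  proof
    fix f assume f: "f \<in> ?L"
    then have "f \<in> T_maps X \<P>" by (simp add: Gamma_maps_def)
    then show "f \<in> ?R"
    proof (rule T_maps_wreath)
      fix s g assume *: "s \<in> self_maps m" "\<forall>i<m. g i \<in> self_maps n" "\<forall>i\<ge>m. g i = id"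
        "f = lift (wreath s g)"
      then have "wreath s g \<in> wreath_maps m (self_maps m) (perms n)"
        using f lift_wreath_in_Gamma_iff[OF *(1,2)] by (intro wreath_mapsI) auto
      then show ?thesis using *(4) by blast
    qed
  qed
  show "?R \<subseteq> ?L" by (auto simp: wreath_maps_def lift_wreath_in_Gamma_iff perms_self_maps)
qed

abbreviation monoid_on :: "('a \<Rightarrow> 'a) set \<Rightarrow> ('a \<Rightarrow> 'a) monoid" where
  "monoid_on C \<equiv> full_transformation_monoid X\<lparr>carrier := C\<rparr>"

lemma finite_X: "finite X"
  using bij_betw_finite[OF bij] by simp

lemma mult_lift: "F \<in> box \<rightarrow> box \<Longrightarrow> lift F \<otimes>\<^bsub>monoid_on C\<^esub> lift G = lift (G \<circ> F)"
  by (simp only: mult_submonoid compose_lift)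

lemma one_lift: "\<one>\<^bsub>monoid_on C\<^esub> = lift id"
  by (simp add: full_transformation_monoid_def lift_id)

lemma wreath_maps_in_box:
  "S \<subseteq> self_maps m \<Longrightarrow> G \<subseteq> self_maps n \<Longrightarrow> wreath_maps m S G \<subseteq> box \<rightarrow> box"
  unfolding wreath_maps_def using wreath_in_box by blast

text \<open>
  Pulling a submonoid back along \<open>lift\<close> gives a set of maps on pairs closed under composition, so
  generation can be checked in coordinates.
\<close>

lemma generates_lift:
  assumes sub: "submonoid (lift ` W) (full_transformation_monoid X)"
    and W: "W \<subseteq> box \<rightarrow> box" and U: "U \<subseteq> W"
    and gen: "\<And>H. comp_closed H \<Longrightarrow> U \<subseteq> H \<Longrightarrow> W \<subseteq> H"
  shows "generates (monoid_on (lift ` W)) (lift ` U)"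
proof (rule generatesI)
  show "monoid (monoid_on (lift ` W))"
    by (rule submonoid.submonoid_is_monoid[OF sub monoid_full_transformation_monoid])
  show "lift ` U \<subseteq> carrier (monoid_on (lift ` W))" using U by auto
  fix H assume H: "submonoid H (monoid_on (lift ` W))" "lift ` U \<subseteq> H"
  let ?A = "{F \<in> box \<rightarrow> box. lift F \<in> H}"
  have "comp_closed ?A"
    unfolding comp_closed_def
  proof (intro conjI ballI)
    show "id \<in> ?A" using submonoid.one_closed[OF H(1)] unfolding one_lift by simp
    fix F G assume FG: "F \<in> ?A" "G \<in> ?A"
    then have "lift G \<otimes>\<^bsub>monoid_on (lift ` W)\<^esub> lift F \<in> H"
      using submonoid.m_closed[OF H(1)] by blast
    then have "lift (F \<circ> G) \<in> H" using FG mult_lift by simp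
    moreover have "F \<circ> G \<in> box \<rightarrow> box"
    proof (rule funcsetI)
      fix p assume "p \<in> box"
      then have "G p \<in> box" using FG(2) by (auto dest: funcset_mem simp del: mem_Sigma_iff split_paired_All)
      then show "(F \<circ> G) p \<in> box"
        using FG(1) unfolding comp_apply by (auto dest: funcset_mem simp del: mem_Sigma_iff split_paired_All)
    qed
    ultimately show "F \<circ> G \<in> ?A" by blast
  qed
  moreover have "U \<subseteq> ?A" using H(2) U W by blast
  ultimately have "W \<subseteq> ?A" by (rule gen)
  then show "carrier (monoid_on (lift ` W)) \<subseteq> H" by auto
qed

lemma inj_on_lift:
  assumes "F \<in> box \<rightarrow> box" "inj_on F box"
  shows "inj_on (lift F) X"
proof -
  have "inj_on (lift F \<circ> \<phi>) box"
  proof (rule inj_onI)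
    fix p q assume pq: "p \<in> box" "q \<in> box" "(lift F \<circ> \<phi>) p = (lift F \<circ> \<phi>) q"
    then have "\<phi> (F p) = \<phi> (F q)" by (simp add: lift_phi)
    moreover have "F p \<in> box" "F q \<in> box" using assms(1) pq(1,2) by blast+
    ultimately have "F p = F q" by (intro iffD1[OF phi_eq])
    then show "p = q" by (rule inj_onD[OF assms(2) _ pq(1,2)])
  qed
  then show ?thesis unfolding range[symmetric] by (rule inj_on_imageI)
qed

section \<open>Lower bounds\<close>

abbreviation block_swap :: "'a \<Rightarrow> 'a" where "block_swap \<equiv> lift (top_map swap01)"
abbreviation point_swap :: "'a \<Rightarrow> 'a" where "point_swap \<equiv> lift (base_map {0} swap01)"
abbreviation block_collapse :: "'a \<Rightarrow> 'a" where "block_collapse \<equiv> lift (top_map collapse)"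
abbreviation point_collapse :: "'a \<Rightarrow> 'a" where "point_collapse \<equiv> lift (base_map {0} collapse)"

lemma corners: "(0, 0) \<in> box" "(0, 1) \<in> box" "(1, 0) \<in> box" "(1, 1) \<in> box"
  using m2 n2 by auto

lemma swaps_in_box: "top_map swap01 \<in> box \<rightarrow> box" "base_map {0} swap01 \<in> box \<rightarrow> box"
  using m2 n2 by (auto simp: top_map_def base_map_def Transposition.transpose_def)

lemma swaps_inj: "inj_on block_swap X" "inj_on point_swap X"
proof -
  have "top_map swap01 \<circ> top_map swap01 = id" "base_map {0} swap01 \<circ> base_map {0} swap01 = id"
    by (simp_all add: top_map_comp base_map_comp)
  then have "inj (top_map swap01)" "inj (base_map {0} swap01)"
    by (metis inj_on_id inj_on_imageI2)+
  then have "inj_on (top_map swap01) box" "inj_on (base_map {0} swap01) box"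
    by (auto intro: inj_on_subset)
  then show "inj_on block_swap X" "inj_on point_swap X"
    by (simp_all only: inj_on_lift[OF swaps_in_box(1)] inj_on_lift[OF swaps_in_box(2)])
qed

text \<open>
  One order sends the point \<open>(0, 0)\<close> to \<open>(1, 0)\<close>, the other to \<open>(1, 1)\<close>.
\<close>

lemma swaps_noncommuting:
  "block_swap \<otimes>\<^bsub>monoid_on C\<^esub> point_swap \<noteq> point_swap \<otimes>\<^bsub>monoid_on C\<^esub> block_swap"
proof
  assume "block_swap \<otimes>\<^bsub>monoid_on C\<^esub> point_swap = point_swap \<otimes>\<^bsub>monoid_on C\<^esub> block_swap"
  then have "lift (base_map {0} swap01 \<circ> top_map swap01) = lift (top_map swap01 \<circ> base_map {0} swap01)"
    using mult_lift swaps_in_box by metis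
  then have "\<phi> ((base_map {0} swap01 \<circ> top_map swap01) (0, 0)) = \<phi> ((top_map swap01 \<circ> base_map {0} swap01) (0, 0))"
    using lift_phi[OF corners(1)] by metis
  then have "\<phi> (1, 0) = \<phi> (1, 1)" by (simp add: top_map_def base_map_def)
  then show False using phi_eq[OF corners(3,4)] by simp
qed

lemma collapses_not_inj: "\<not> inj_on block_collapse X" "\<not> inj_on point_collapse X"
proof -
  have "block_collapse (\<phi> (0, 0)) = block_collapse (\<phi> (1, 0))"
    using corners by (simp add: lift_phi top_map_def collapse_def)
  then show "\<not> inj_on block_collapse X"
    using phi_eq[OF corners(1,3)] phi_in[OF corners(1)] phi_in[OF corners(3)]
    by (auto dest: inj_onD)
  have "point_collapse (\<phi> (0, 0)) = point_collapse (\<phi> (0, 1))"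
    using corners by (simp add: lift_phi base_map_def collapse_def)
  then show "\<not> inj_on point_collapse X"
    using phi_eq[OF corners(1,2)] phi_in[OF corners(1)] phi_in[OF corners(2)]
    by (auto dest: inj_onD)
qed

lemma swap01_in_perms: "swap01 \<in> perms m" "swap01 \<in> perms n"
  using m2 n2 by (auto intro: permutes_swap_id)

lemma collapse_in_self_maps: "collapse \<in> self_maps m" "collapse \<in> self_maps n"
  using m2 n2 by (auto simp: collapse_def self_maps_def)

lemmas in_wreath_maps =
  top_map_in_wreath_maps[OF _ comp_closed_perms] top_map_in_wreath_maps[OF _ comp_closed_self_maps]
  base_map_in_wreath_maps[OF _ _ comp_closed_perms comp_closed_self_maps]
  base_map_in_wreath_maps[OF _ _ comp_closed_self_maps comp_closed_self_maps]
  base_map_in_wreath_maps[OF _ _ comp_closed_self_maps comp_closed_perms]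

lemma wreath_maps_mono: "S \<subseteq> S' \<Longrightarrow> G \<subseteq> G' \<Longrightarrow> wreath_maps m S G \<subseteq> wreath_maps m S' G'"
  unfolding wreath_maps_def by blast

lemma swaps_mem:
  "block_swap \<in> Sigma_maps X \<P>" "point_swap \<in> Sigma_maps X \<P>"
  "block_swap \<in> Gamma_maps X \<P>" "point_swap \<in> Gamma_maps X \<P>"
  unfolding Sigma_maps_eq Gamma_maps_eq using m2 swap01_in_perms perms_self_maps
  by (auto intro!: imageI in_wreath_maps)

lemma collapses_mem:
  "point_collapse \<in> Sigma_maps X \<P>" "block_collapse \<in> Gamma_maps X \<P>" "block_collapse \<in> T_maps X \<P>"
  unfolding Sigma_maps_eq Gamma_maps_eq T_maps_eq using m2 collapse_in_self_maps
  by (auto intro!: imageI in_wreath_maps)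

lemma block_collapse_not_Sigma: "block_collapse \<notin> Sigma_maps X \<P>"
proof -
  have "top_map collapse = wreath collapse (\<lambda>_. id)" by (auto simp: top_map_def wreath_def)
  moreover have "\<not> collapse permutes {..<m}"
    using permutes_inj[of collapse "{..<m}"] injD[of collapse 0 1] by (auto simp: collapse_def)
  moreover have "id \<in> self_maps n" by (simp add: self_maps_def)
  ultimately show ?thesis
    using lift_wreath_in_Sigma_iff[of collapse "\<lambda>_. id"] collapse_in_self_maps by simp
qed

lemma monoid_monoid_on: "submonoid C (full_transformation_monoid X) \<Longrightarrow> monoid (monoid_on C)"
  by (rule submonoid.submonoid_is_monoid[OF _ monoid_full_transformation_monoid])

text \<open>
  Two generators are injective, and the non-injective \<open>c\<close> requires a third.
\<close>

lemma three_le_card_generators: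
  assumes sub: "submonoid C (full_transformation_monoid X)"
    and V: "generates (monoid_on C) V" "finite V"
    and swaps: "block_swap \<in> C" "point_swap \<in> C" and c: "c \<in> C" "\<not> inj_on c X"
  shows "3 \<le> card V"
proof -
  let ?M = "monoid_on C" and ?G = "{f \<in> C. inj_on f X}"
  note M = monoid_monoid_on[OF sub]
  note G = factor_closed_injective[OF finite_X sub]
  obtain u v where uv: "u \<noteq> v" "u \<in> V" "v \<in> V" "u \<in> ?G" "v \<in> ?G"
    using two_generators_of_noncommuting[OF M G V(1) _ _ swaps_noncommuting] swaps swaps_inj
    by blast
  obtain w where w: "w \<in> V" "w \<notin> ?G"
    using generator_outside_factor_closed[OF M _ factor_closed_carrier[OF M] V(1), of ?G c] G c
    unfolding factor_closed_def by auto
  have "w \<noteq> u" "w \<noteq> v" using uv(4,5) w(2) by blast+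
  then have "card {u, v, w} = 3" using uv(1) by simp
  moreover have "{u, v, w} \<subseteq> V" using uv w by blast
  ultimately show ?thesis using card_mono[OF V(2)] by metis
qed

text \<open>
  The top map of a product is the composition of the top maps, and a composition of self-maps of a
  finite set is a permutation only if both of them are.
\<close>

lemma factor_closed_Sigma: "factor_closed (monoid_on (T_maps X \<P>)) (Sigma_maps X \<P>)"
proof -
  let ?M = "monoid_on (T_maps X \<P>)"
  have "Sigma_maps X \<P> \<subseteq> T_maps X \<P>" by (auto simp: Sigma_maps_def T_maps_def)
  then have sub: "submonoid (Sigma_maps X \<P>) ?M"
    using submonoid_Sigma_maps[of X \<P>] by (simp add: submonoid_def)
  have "f \<in> Sigma_maps X \<P> \<and> f' \<in> Sigma_maps X \<P>"
    if ff: "f \<in> T_maps X \<P>" "f' \<in> T_maps X \<P>" "f \<otimes>\<^bsub>?M\<^esub> f' \<in> Sigma_maps X \<P>" for f f'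
  proof -
    obtain s g where f: "s \<in> self_maps m" "\<forall>i<m. g i \<in> self_maps n" "f = lift (wreath s g)"
      using T_maps_wreath[OF ff(1)] by metis
    obtain s' g' where f': "s' \<in> self_maps m" "\<forall>i<m. g' i \<in> self_maps n" "f' = lift (wreath s' g')"
      using T_maps_wreath[OF ff(2)] by metis
    have "f \<otimes>\<^bsub>?M\<^esub> f' = lift (wreath s' g' \<circ> wreath s g)"
      unfolding f(3) f'(3) by (rule mult_lift[OF wreath_in_box[OF f(1,2)]])
    also have "wreath s' g' \<circ> wreath s g = wreath (s' \<circ> s) (\<lambda>i. g' (s i) \<circ> g i)"
      by (auto simp: wreath_def fun_eq_iff)
    finally have "lift (wreath (s' \<circ> s) (\<lambda>i. g' (s i) \<circ> g i)) \<in> Sigma_maps X \<P>"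
      using ff(3) by simp
    moreover have "s' \<circ> s \<in> self_maps m"
      by (rule comp_closed_comp[OF comp_closed_self_maps f'(1) f(1)])
    moreover have "g' (s i) \<circ> g i \<in> self_maps n" if "i < m" for i
    proof (rule comp_closed_comp[OF comp_closed_self_maps])
      have "s i < m" using f(1) that by (simp add: self_maps_def)
      then show "g' (s i) \<in> self_maps n" using f'(2) by blast
      show "g i \<in> self_maps n" using f(2) that by blast
    qed
    ultimately have p: "s' \<circ> s permutes {..<m}"
      using lift_wreath_in_Sigma_iff[of "s' \<circ> s" "\<lambda>i. g' (s i) \<circ> g i"] by simp
    then have inj: "inj_on (s' \<circ> s) {..<m}" by (rule permutes_inj_on)
    have s: "s permutes {..<m}"
      by (rule inj_self_map_permutes[OF f(1) inj_on_imageI2[OF inj]])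
    have "inj_on s' (s ` {..<m})" using inj by (rule inj_on_imageI)
    then have "s' permutes {..<m}"
      using f'(1) permutes_image[OF s] by (intro inj_self_map_permutes) simp_all
    then show ?thesis
      using s lift_wreath_in_Sigma_iff[OF f(1,2)] lift_wreath_in_Sigma_iff[OF f'(1,2)] f(3) f'(3)
      by (simp only: simp_thms)
  qed
  then show ?thesis using sub unfolding factor_closed_def by simp
qed

text \<open>
  The chain of factor-closed submonoids starts with two generators for the injective maps in
  \<open>\<Sigma>\<close>. Identifying two points of one part stays in \<open>\<Sigma>\<close> but is not injective; identifying two parts
  leaves \<open>\<Sigma>\<close>.
\<close>

lemma four_le_card_generators:
  assumes V: "generates (monoid_on (T_maps X \<P>)) V" "finite V"
  shows "4 \<le> card V"
proof -
  let ?C = "T_maps X \<P>"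
  let ?M = "monoid_on ?C" and ?G = "{f \<in> ?C. inj_on f X} \<inter> Sigma_maps X \<P>"
  note M = monoid_monoid_on[OF submonoid_T_maps[of X \<P>]]
  note K = factor_closed_Sigma
  have G: "factor_closed ?M ?G"
    by (rule factor_closed_Int[OF factor_closed_injective[OF finite_X submonoid_T_maps] K])
  have sub: "Sigma_maps X \<P> \<subseteq> ?C" by (auto simp: Sigma_maps_def T_maps_def)
  obtain u v where uv: "u \<noteq> v" "u \<in> V" "v \<in> V" "u \<in> ?G" "v \<in> ?G"
    using two_generators_of_noncommuting[OF M G V(1) _ _ swaps_noncommuting] swaps_mem(1,2) swaps_inj sub
    by blast
  obtain w where w: "w \<in> V" "w \<in> Sigma_maps X \<P>" "w \<notin> ?G"
    using generator_outside_factor_closed[OF M _ K V(1), of ?G point_collapse] G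
      collapses_mem(1) collapses_not_inj(2)
    unfolding factor_closed_def by blast
  obtain z where z: "z \<in> V" "z \<notin> Sigma_maps X \<P>"
    using generator_outside_factor_closed[OF M _ factor_closed_carrier[OF M] V(1), of "Sigma_maps X \<P>" block_collapse]
      K collapses_mem(3) block_collapse_not_Sigma
    unfolding factor_closed_def by auto
  have "w \<noteq> u" "w \<noteq> v" "z \<noteq> u" "z \<noteq> v" "z \<noteq> w" using uv(4,5) w(2,3) z(2) by blast+
  then have "card {u, v, w, z} = 4" using uv(1) by simp
  moreover have "{u, v, w, z} \<subseteq> V" using uv w z by blast
  ultimately show ?thesis using card_mono[OF V(2)] by metis
qed

section \<open>The ranks\<close>

lemma unit_gens_mem:
  assumes "perms m \<subseteq> S" "perms n \<subseteq> G"
  shows "unit_gen1 m \<in> wreath_maps m S G" "unit_gen2 m n \<in> wreath_maps m S G"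
  using unit_gens_in_wreath_maps[OF m2 n2] wreath_maps_mono[OF assms] by blast+

lemma monoid_rank_T: "monoid_rank (T_monoid X \<P>) = 4"
proof (rule monoid_rank_eqI)
  let ?W = "wreath_maps m (self_maps m) (self_maps n)"
    and ?U = "{unit_gen1 m, unit_gen2 m n, top_map collapse, base_map {0} collapse}"
  have "?U \<subseteq> ?W"
    using unit_gens_mem[OF perms_subset_self_maps perms_subset_self_maps] m2 collapse_in_self_maps
    by (auto intro: in_wreath_maps)
  then have "generates (monoid_on (lift ` ?W)) (lift ` ?U)"
    using submonoid_T_maps[of X \<P>, unfolded T_maps_eq] wreath_maps_in_box[OF order_refl order_refl]
      wreath_maps_generated_by(3)[OF _ m2 n2]
    by (intro generates_lift) auto
  then show "generates (T_monoid X \<P>) (lift ` ?U)" by (simp only: T_monoid_def T_maps_eq)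
  show "card (lift ` ?U) \<le> 4"
    by (rule order_trans[OF card_image_le]) (simp_all add: card_insert_if)
  show "4 \<le> card V" if "generates (T_monoid X \<P>) V" "finite V" for V
    using four_le_card_generators that by (simp add: T_monoid_def)
qed simp

lemma monoid_rank_Sigma: "monoid_rank (Sigma_monoid X \<P>) = 3"
proof (rule monoid_rank_eqI)
  let ?W = "wreath_maps m (perms m) (self_maps n)"
    and ?U = "{unit_gen1 m, unit_gen2 m n, base_map {0} collapse}"
  have "?U \<subseteq> ?W"
    using unit_gens_mem[OF order_refl perms_subset_self_maps] m2 collapse_in_self_maps
    by (auto intro: in_wreath_maps)
  then have "generates (monoid_on (lift ` ?W)) (lift ` ?U)"
    using submonoid_Sigma_maps[of X \<P>, unfolded Sigma_maps_eq]
      wreath_maps_in_box[OF perms_subset_self_maps order_refl] wreath_maps_generated_by(2)[OF _ m2 n2]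
    by (intro generates_lift) auto
  then show "generates (Sigma_monoid X \<P>) (lift ` ?U)"
    by (simp only: Sigma_monoid_def Sigma_maps_eq)
  show "card (lift ` ?U) \<le> 3"
    by (rule order_trans[OF card_image_le]) (simp_all add: card_insert_if)
  show "3 \<le> card V" if "generates (Sigma_monoid X \<P>) V" "finite V" for V
    using three_le_card_generators[OF submonoid_Sigma_maps _ that(2) swaps_mem(1,2)
        collapses_mem(1) collapses_not_inj(2)] that(1)
    by (simp add: Sigma_monoid_def)
qed simp

lemma monoid_rank_Gamma:
  assumes "partition_on X \<P>"
  shows "monoid_rank (Gamma_monoid X \<P>) = 3"
proof (rule monoid_rank_eqI)
  let ?W = "wreath_maps m (self_maps m) (perms n)"
    and ?U = "{unit_gen1 m, unit_gen2 m n, top_map collapse}"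
  have "?U \<subseteq> ?W"
    using unit_gens_mem[OF perms_subset_self_maps order_refl] m2 collapse_in_self_maps
    by (auto intro: in_wreath_maps)
  then have "generates (monoid_on (lift ` ?W)) (lift ` ?U)"
    using submonoid_Gamma_maps[OF assms, unfolded Gamma_maps_eq]
      wreath_maps_in_box[OF order_refl perms_subset_self_maps] wreath_maps_generated_by(1)[OF _ m2 n2]
    by (intro generates_lift) auto
  then show "generates (Gamma_monoid X \<P>) (lift ` ?U)"
    by (simp only: Gamma_monoid_def Gamma_maps_eq)
  show "card (lift ` ?U) \<le> 3"
    by (rule order_trans[OF card_image_le]) (simp_all add: card_insert_if)
  show "3 \<le> card V" if "generates (Gamma_monoid X \<P>) V" "finite V" for V
    using three_le_card_generators[OF submonoid_Gamma_maps[OF assms] _ that(2) swaps_mem(3,4)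
        collapses_mem(2) collapses_not_inj(1)] that(1)
    by (simp add: Gamma_monoid_def)
qed simp

end

text \<open>
  From \<open>|X| = m n\<close>, having neither \<open>1\<close> nor \<open>|X|\<close> parts means \<open>m \<noteq> 1\<close> and \<open>n \<noteq> 1\<close>.
\<close>

lemma coordinates_exist:
  fixes X :: "'a set" and \<P> :: "'a set set"
  assumes fin: "finite X" and ne: "X \<noteq> {}" and part: "partition_on X \<P>"
    and unif: "uniform_partition \<P>" and nontriv: "\<not> trivial_partition X \<P>"
  obtains m n \<phi> where "coordinates X \<P> m n \<phi>"
proof -
  have finP: "finite \<P>" using part fin by (rule finite_elements[rotated])
  have sub: "P \<subseteq> X" if "P \<in> \<P>" for P using that part by (auto simp: partition_on_def)
  have union: "\<Union>\<P> = X" and disj: "disjoint \<P>" and nonempty: "{} \<notin> \<P>"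
    using part by (auto simp: partition_on_def)
  define m where "m = card \<P>"
  obtain P0 where P0: "P0 \<in> \<P>" using ne union by blast
  define n where "n = card P0"
  have cardP: "card P = n" if "P \<in> \<P>" for P
    using unif that P0 unfolding uniform_partition_def n_def by blast
  have finpart: "finite P" if "P \<in> \<P>" for P using sub[OF that] fin by (rule finite_subset)
  have "card X = (\<Sum>P\<in>\<P>. card P)"
    unfolding union[symmetric] using disj finpart
    by (intro card_Union_disjoint) (auto simp: disjoint_def pairwise_def disjnt_def)
  then have cardX: "card X = m * n" using cardP by (simp add: m_def)
  have "n \<noteq> 0" using P0 nonempty finpart[OF P0] by (auto simp: n_def)
  moreover have "m \<noteq> 0" using P0 finP by (auto simp: m_def)
  moreover have "m \<noteq> 1" "n \<noteq> 1"
    using nontriv cardX by (auto simp: trivial_partition_def m_def)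
  ultimately have mn: "m \<ge> 2" "n \<ge> 2" by auto
  obtain p where p: "bij_betw p {..<m} \<P>"
    using ex_bij_betw_nat_finite[OF finP] by (auto simp: m_def atLeast0LessThan)
  have "\<exists>q. bij_betw q {..<n} P" if "P \<in> \<P>" for P
    using ex_bij_betw_nat_finite[OF finpart[OF that]] cardP[OF that] by (simp add: atLeast0LessThan)
  then obtain q where q: "\<And>P. P \<in> \<P> \<Longrightarrow> bij_betw (q P) {..<n} P" by metis
  define \<phi> where "\<phi> = (\<lambda>(i, j). q (p i) j)"
  have pP: "p i \<in> \<P>" if "i < m" for i using that p by (auto simp: bij_betw_def)
  have block: "\<phi> ` ({i} \<times> {..<n}) = p i" if "i < m" for i
    using q[OF pP[OF that]] by (force simp: \<phi>_def bij_betw_def)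
  have eqP: "\<P> = (\<lambda>i. \<phi> ` ({i} \<times> {..<n})) ` {..<m}"
    using p block by (auto simp: bij_betw_def)
  have "inj_on \<phi> ({..<m} \<times> {..<n})"
  proof (rule inj_onI, clarsimp)
    fix i j i' j' assume ij: "i < m" "j < n" "i' < m" "j' < n" "\<phi> (i, j) = \<phi> (i', j')"
    have "\<phi> (i, j) \<in> p i" "\<phi> (i, j) \<in> p i'" using ij block by (metis SigmaI imageI insertI1 lessThan_iff)+
    then have "p i = p i'" using disj pP ij by (auto simp: disjoint_def)
    then have i: "i = i'" using p ij by (auto simp: bij_betw_def inj_on_def)
    then have "q (p i) j = q (p i) j'" using ij by (simp add: \<phi>_def)
    then show "i = i' \<and> j = j'" using i q[OF pP[OF ij(1)]] ij by (auto simp: bij_betw_def inj_on_def)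
  qed
  moreover have "\<phi> ` ({..<m} \<times> {..<n}) = X"
  proof -
    have "\<phi> ` ({..<m} \<times> {..<n}) = \<Union>\<P>" unfolding eqP by auto
    then show ?thesis using union by simp
  qed
  ultimately have "coordinates X \<P> m n \<phi>"
    using eqP mn by unfold_locales (auto simp: bij_betw_def)
  then show thesis by (rule that)
qed

theorem theorem1p1:
  fixes X :: "'a set" and \<P> :: "'a set set"
  assumes "finite X"
    and "card X \<ge> 3"
    and "partition_on X \<P>"
    and "uniform_partition \<P>"
    and "\<not> trivial_partition X \<P>"
  shows "monoid_rank (T_monoid X \<P>) = 4
    \<and> monoid_rank (Sigma_monoid X \<P>) = 3
    \<and> monoid_rank (Gamma_monoid X \<P>) = 3"
proof -
  have "X \<noteq> {}" using assms(2) by auto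
  then obtain m n \<phi> where "coordinates X \<P> m n \<phi>"
    using coordinates_exist[OF assms(1) _ assms(3-5)] by blast
  then interpret coordinates X \<P> m n \<phi> .
  show ?thesis using monoid_rank_T monoid_rank_Sigma monoid_rank_Gamma[OF assms(3)] by blast
qed

end
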